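(* Let $A^\star\in\mathbb{R}^{n\times n}$, $B^\star\in\mathbb{R}^{n\times m}$, $C^\star\in\mathbb{R}^{p\times n}$ with $(A^\star,C^\star)$ observable, and let $\ell^\star$ be the observability index of $(A^\star,C^\star)$. Let data $\{u^{\mathrm m}(k),y^{\mathrm m}(k)\}_{k=0}^T$ (with $T\ge \ell^\star$) be generated as described in the context, let $\Psi_0,\Psi_1,\Theta,\Theta_{11},\Theta_{12},\Theta_{22},\mathscr{A},\mathscr{B},\mathscr{C},\mathbf{F}_{\ell^\star},\mathbf{L}_{\ell^\star},\mathbf{B}_{\ell^\star}$ be as defined in the context, assume the noise matrix satisfies $\Delta_{10}\Delta_{10}^\top\preceq\Theta$ and assume $\Psi_0\Psi_0^\top\succ\Theta_{22}$. Suppose there exist $\mathbf{Y}\in\mathbb{R}^{m\times(p\ell^\star+m\ell^\star)}$ and $P=P^\top\succ0$ such that $$\begin{bmatrix}-P-\mathbf{L}_{\ell^\star}\mathscr{C}\mathbf{L}_{\ell^\star}^\top & \mathbf{F}_{\ell^\star}P+\mathbf{B}_{\ell^\star}\mathbf{Y} & \mathbf{L}_{\ell^\star}\mathscr{B}\\ P\mathbf{F}_{\ell^\star}^\top+\mathbf{Y}^\top\mathbf{B}_{\ell^\star}^\top & -P & -P\\ \mathscr{B}^\top\mathbf{L}_{\ell^\star}^\top & -P & -\mathscr{A}\end{bmatrix}\prec0,$$ and let $\mathbf{K}=\mathbf{Y}P^{-1}$. Then $(x,\chi)=0$ is globally asymptotically stable for the feedback interconnection of the plant $x^+=A^\star x+B^\star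 u$, $y=C^\star x$ and the controller $\chi^+=(\mathbf{F}_{\ell^\star}+\mathbf{B}_{\ell^\star}\mathbf{K})\chi+\mathbf{L}_{\ell^\star}y$, $u=\mathbf{K}\chi$. Moreover, along every solution of this interconnection, for each $k\ge\ell^\star$, $\chi(k)=(y(k-\ell^\star),\dots,y(k-1),u(k-\ell^\star),\dots,u(k-1))$.
   Context: Notation: $(v_1,\dots,v_r)$ denotes the stacked column vector; $M\succ0$ ($\succeq0$) means positive (semi)definite. The observability index of an observable pair $(A,C)$ is the smallest $l$ with $\operatorname{rank}[C;CA;\dots;CA^{l-1}]=n$. Auxiliary matrices for $\ell=\ell^\star$: $\mathbf{F}_\ell=\mathrm{blockdiag}(S_p,S_m)$ where $S_q\in\mathbb{R}^{q\ell\times q\ell}$ has identity blocks $I_q$ on the first block superdiagonal (block $(i,i+1)$, $i=1,\dots,\ell-1$) and zeros elsewhere; $\mathbf{L}_\ell\in\mathbb{R}^{(p\ell+m\ell)\times p}$ has $I_p$ in its rows $p\ell-p+1,\dots,p\ell$ and zeros elsewhere; $\mathbf{B}_\ell\in\mathbb{R}^{(p\ell+m\ell)\times m}$ has $I_m$ in its last $m$ rows and zeros elsewhere. Data generation: for $k=0,\dots,T$, $x(k+1)=A^\star x(k)+B^\star u(k)$, $y(k)=C^\star x(k)$, from some initial $x(0)$, with unknown noises $d^u,d^y$ and measured signals $u^{\mathrm m}(k)=u(k)+d^u(k)$, $y^{\mathrm m}(k)=y(k)+d^y(k)$. With $\ell=\ell^\star$, define matrices with $T-\ell+1$ columns indexed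 by $j=0,\dots,T-\ell$: column $j$ of $\Psi_1$ is $(y^{\mathrm m}(j+1),\dots,y^{\mathrm m}(j+\ell),u^{\mathrm m}(j+1),\dots,u^{\mathrm m}(j+\ell))$; column $j$ of $\Psi_0$ is $(y^{\mathrm m}(j),\dots,y^{\mathrm m}(j+\ell-1),u^{\mathrm m}(j),\dots,u^{\mathrm m}(j+\ell-1))$; column $j$ of $\Delta_{10}$ is $(d^y(j+\ell),d^y(j),\dots,d^y(j+\ell-1),d^u(j),\dots,d^u(j+\ell-1))$. $\Theta=\Theta^\top\succeq0$ is a given matrix of size $(p+p\ell+m\ell)$, partitioned as $\Theta=\begin{bmatrix}\Theta_{11}&\Theta_{12}\\\Theta_{12}^\top&\Theta_{22}\end{bmatrix}$ with $\Theta_{11}\in\mathbb{R}^{p\times p}$. Define $\mathscr{A}=\Psi_0\Psi_0^\top-\Theta_{22}$, $\mathscr{B}=-\mathbf{L}_\ell^\top\Psi_1\Psi_0^\top+\Theta_{12}$, $\mathscr{C}=\mathbf{L}_\ell^\top\Psi_1\Psi_1^\top\mathbf{L}_\ell-\Theta_{11}$. *)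

theory Defs
  imports "Jordan_Normal_Form.Matrix" "Jordan_Normal_Form.DL_Rank"
    "Jordan_Normal_Form.Gauss_Jordan_Elimination"
begin

definition psd_mat :: "nat \<Rightarrow> real mat \<Rightarrow> bool" where
  "psd_mat d M \<longleftrightarrow> M \<in> carrier_mat d d \<and> transpose_mat M = M \<and>
     (\<forall>v \<in> carrier_vec d. v \<bullet> (M *\<^sub>v v) \<ge> 0)"

definition pd_mat :: "nat \<Rightarrow> real mat \<Rightarrow> bool" where
  "pd_mat d M \<longleftrightarrow> M \<in> carrier_mat d d \<and> transpose_mat M = M \<and>
     (\<forall>v \<in> carrier_vec d. v \<noteq> 0\<^sub>v d \<longrightarrow> v \<bullet> (M *\<^sub>v v) > 0)"

definition nd_mat :: "nat \<Rightarrow> real mat \<Rightarrow> bool" where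
  "nd_mat d M \<longleftrightarrow> pd_mat d (- M)"

definition obs_mat :: "real mat \<Rightarrow> real mat \<Rightarrow> nat \<Rightarrow> real mat" where
  "obs_mat C A l = mat (dim_row C * l) (dim_col A)
     (\<lambda>(i,j). (C * (A ^\<^sub>m (i div dim_row C))) $$ (i mod dim_row C, j))"

definition obs_rank :: "real mat \<Rightarrow> real mat \<Rightarrow> nat \<Rightarrow> nat" where
  "obs_rank C A l = vec_space.rank (dim_row C * l) (obs_mat C A l)"

definition observable :: "nat \<Rightarrow> real mat \<Rightarrow> real mat \<Rightarrow> bool" where
  "observable n A C \<longleftrightarrow> (\<exists>l. obs_rank C A l = n)"

definition obs_index :: "nat \<Rightarrow> real mat \<Rightarrow> real mat \<Rightarrow> nat" where
  "obs_index n A C = (LEAST l. obs_rank C A l = n)"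

definition shift_mat :: "nat \<Rightarrow> nat \<Rightarrow> real mat" where
  "shift_mat q l = mat (q*l) (q*l) (\<lambda>(i,j). if j = i + q then 1 else 0)"

definition F_mat :: "nat \<Rightarrow> nat \<Rightarrow> nat \<Rightarrow> real mat" where
  "F_mat p m l = four_block_mat (shift_mat p l) (0\<^sub>m (p*l) (m*l))
                                (0\<^sub>m (m*l) (p*l)) (shift_mat m l)"

definition L_mat :: "nat \<Rightarrow> nat \<Rightarrow> nat \<Rightarrow> real mat" where
  "L_mat p m l = mat (p*l + m*l) p (\<lambda>(i,j). if i = p*l - p + j then 1 else 0)"

definition B_mat :: "nat \<Rightarrow> nat \<Rightarrow> nat \<Rightarrow> real mat" where
  "B_mat p m l = mat (p*l + m*l) m (\<lambda>(i,j). if i = p*l + m*l - m + j then 1 else 0)"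

definition stackv :: "nat \<Rightarrow> (nat \<Rightarrow> real vec) \<Rightarrow> nat \<Rightarrow> nat \<Rightarrow> real vec" where
  "stackv q f s l = vec (q*l) (\<lambda>i. f (s + i div q) $ (i mod q))"

definition cols_mat :: "nat \<Rightarrow> nat \<Rightarrow> (nat \<Rightarrow> real vec) \<Rightarrow> real mat" where
  "cols_mat d ncols g = mat d ncols (\<lambda>(i,c). g c $ i)"

definition Psi_mat :: "nat \<Rightarrow> nat \<Rightarrow> nat \<Rightarrow> nat \<Rightarrow> (nat \<Rightarrow> real vec) \<Rightarrow> (nat \<Rightarrow> real vec)
    \<Rightarrow> nat \<Rightarrow> real mat" where
  "Psi_mat p m l T ym um s = cols_mat (p*l + m*l) (T - l + 1)
     (\<lambda>j. stackv p ym (j + s) l @\<^sub>v stackv m um (j + s) l)"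

definition Delta10_mat :: "nat \<Rightarrow> nat \<Rightarrow> nat \<Rightarrow> nat \<Rightarrow> (nat \<Rightarrow> real vec) \<Rightarrow> (nat \<Rightarrow> real vec)
    \<Rightarrow> real mat" where
  "Delta10_mat p m l T dy du = cols_mat (p + p*l + m*l) (T - l + 1)
     (\<lambda>j. dy (j + l) @\<^sub>v stackv p dy j l @\<^sub>v stackv m du j l)"

definition Th11 :: "nat \<Rightarrow> real mat \<Rightarrow> real mat" where
  "Th11 p Th = mat p p (\<lambda>(i,j). Th $$ (i,j))"
definition Th12 :: "nat \<Rightarrow> nat \<Rightarrow> real mat \<Rightarrow> real mat" where
  "Th12 p N Th = mat p N (\<lambda>(i,j). Th $$ (i, p + j))"
definition Th22 :: "nat \<Rightarrow> nat \<Rightarrow> real mat \<Rightarrow> real mat" where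
  "Th22 p N Th = mat N N (\<lambda>(i,j). Th $$ (p + i, p + j))"

definition block3 :: "real mat \<Rightarrow> real mat \<Rightarrow> real mat \<Rightarrow> real mat \<Rightarrow> real mat \<Rightarrow> real mat
    \<Rightarrow> real mat \<Rightarrow> real mat \<Rightarrow> real mat \<Rightarrow> real mat" where
  "block3 M11 M12 M13 M21 M22 M23 M31 M32 M33 =
     four_block_mat M11 (four_block_mat M12 M13 (0\<^sub>m 0 (dim_col M12)) (0\<^sub>m 0 (dim_col M13)))
       (four_block_mat M21 (0\<^sub>m (dim_row M21) 0) M31 (0\<^sub>m (dim_row M31) 0))
       (four_block_mat M22 M23 M32 M33)"

definition cl_solution :: "nat \<Rightarrow> nat \<Rightarrow> real mat \<Rightarrow> real mat \<Rightarrow> real mat \<Rightarrow> real mat \<Rightarrow> real mat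
    \<Rightarrow> real mat \<Rightarrow> real mat \<Rightarrow> (nat \<Rightarrow> real vec) \<Rightarrow> (nat \<Rightarrow> real vec) \<Rightarrow> bool" where
  "cl_solution n N A B C F L Bl K x chi \<longleftrightarrow>
     x 0 \<in> carrier_vec n \<and> chi 0 \<in> carrier_vec N \<and>
     (\<forall>k. x (Suc k) = A *\<^sub>v x k + B *\<^sub>v (K *\<^sub>v chi k) \<and>
          chi (Suc k) = (F + Bl * K) *\<^sub>v chi k + L *\<^sub>v (C *\<^sub>v x k))"

definition vnorm :: "real vec \<Rightarrow> real" where
  "vnorm v = sqrt (v \<bullet> v)"

definition cl_GAS :: "nat \<Rightarrow> nat \<Rightarrow> real mat \<Rightarrow> real mat \<Rightarrow> real mat \<Rightarrow> real mat \<Rightarrow> real mat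
    \<Rightarrow> real mat \<Rightarrow> real mat \<Rightarrow> bool" where
  "cl_GAS n N A B C F L Bl K \<longleftrightarrow>
     (\<forall>\<epsilon>>0. \<exists>\<delta>>0. \<forall>x chi. cl_solution n N A B C F L Bl K x chi \<and> vnorm (x 0 @\<^sub>v chi 0) < \<delta>
        \<longrightarrow> (\<forall>k. vnorm (x k @\<^sub>v chi k) < \<epsilon>)) \<and>
     (\<forall>x chi. cl_solution n N A B C F L Bl K x chi \<longrightarrow>
        (\<lambda>k. vnorm (x k @\<^sub>v chi k)) \<longlonglongrightarrow> 0)"

end

(*
  By observability, the state at the end of a window of length l is a linear function of the
  inputs and outputs in that window, x(k+l) = R w(k), so y(k+l) = Z w(k) with Z = C R.  The noise
  bound turns the recorded data into a quadratic matrix inequality satisfied by Z.  The controller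
  is a shift register: after l steps chi is exactly the window of past outputs and inputs, so
  x = R chi and chi evolves autonomously under M = F + B K + L Z.  Evaluating the LMI at
  (a, b, -Z^T L^T a) eliminates the data blocks and, with S = P^-1, a = S M v and b = S v, gives
  v^T M^T S M v < v^T S v.  Thus v^T S v is a strict Lyapunov function for chi after l steps, and the first l steps are
  bounded by a finite power of the one-step gain.
*)
theory Submission
  imports Defs
begin

section \<open>Real matrices and quadratic forms\<close>

text \<open>The samples need not determine the plant, and windows live in dimension
  \<open>p*l + m*l\<close>, which need not be \<open>n\<close>. What ties the experiment to the
  closed loop is that \<open>Z\<close> is chosen from \<open>A\<close>, \<open>B\<close>,
  \<open>C\<close> before any trajectory: the same \<open>Z\<close> explains the noisy samples and
  drives the controller. For a test vector \<open>w\<close>, the pair \<open>(w, - Z^T w)\<close>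
  annihilates the noise-free part of every sample, because each output equals \<open>Z\<close> times
  the window before it. Only noise is left, and there the bound by \<open>Th\<close> enters. The
  third component inserted into the LMI is this same vector with \<open>w = L^T a\<close>. The
  decrease is proved for every \<open>v\<close>, whether or not it is the window of some trajectory,
  so \<open>M\<close> can be treated as a linear system of its own. In the first \<open>l\<close>
  steps \<open>chi 0\<close> is unrelated to \<open>x 0\<close>, so neither \<open>x = R chi\<close>
  nor the recursion by \<open>M\<close> is available; that phase has a fixed length, so a linear
  growth bound settles it.\<close>

lemma psd_mat_cauchy_schwarz:
  assumes Q: "psd_mat d Q" and v: "v \<in> carrier_vec d" and w: "w \<in> carrier_vec d"
  shows "(v \<bullet> (Q *\<^sub>v w))\<^sup>2 \<le> (v \<bullet> (Q *\<^sub>v v)) * (w \<bullet> (Q *\<^sub>v w))"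
proof -
  have Qc: "Q \<in> carrier_mat d d" and Qt: "transpose_mat Q = Q"
    and nn: "\<And>z. z \<in> carrier_vec d \<Longrightarrow> z \<bullet> (Q *\<^sub>v z) \<ge> 0"
    using Q by (auto simp: psd_mat_def)
  let ?a = "v \<bullet> (Q *\<^sub>v v)" and ?b = "v \<bullet> (Q *\<^sub>v w)" and ?c = "w \<bullet> (Q *\<^sub>v w)"
  have sym: "w \<bullet> (Q *\<^sub>v v) = ?b"
    using transpose_vec_mult_scalar[OF Qc v w] comm_scalar_prod[of "Q *\<^sub>v w" d v] Qc Qt v w by auto
  have quad: "0 \<le> ?a + 2 * t * ?b + t\<^sup>2 * ?c" for t
  proof -
    have "(v + t \<cdot>\<^sub>v w) \<bullet> (Q *\<^sub>v (v + t \<cdot>\<^sub>v w)) = ?a + 2 * t * ?b + t\<^sup>2 * ?c"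
      using Qc v w sym
      by (simp add: mult_add_distrib_mat_vec[of _ d d] mult_mat_vec[of _ d d]
          add_scalar_prod_distrib[of _ d] scalar_prod_add_distrib[of _ d] power2_eq_square algebra_simps)
    then show ?thesis using nn[of "v + t \<cdot>\<^sub>v w"] v w by simp
  qed
  show ?thesis
  proof (cases "?c = 0")
    case True
    have "?b = 0"
    proof (rule ccontr)
      assume "?b \<noteq> 0"
      \<comment> \<open>The quadratic has become affine in \<open>t\<close>; at this
        \<open>t\<close> it equals -1.\<close>
      then show False using quad[of "- (?a + 1) / (2 * ?b)"] True by (simp add: field_simps)
    qed
    then show ?thesis using True by simp
  next
    case False
    then have c: "?c > 0" using nn[OF w] by simp
    \<comment> \<open>\<open>t = - ?b / ?c\<close> minimises the quadratic; nonnegativity there is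
      the claim divided by \<open>?c\<close>.\<close>
    have "?a + 2 * (- ?b / ?c) * ?b + (- ?b / ?c)\<^sup>2 * ?c = ?a - ?b\<^sup>2 / ?c"
      using False by (simp add: field_simps power2_eq_square)
    then have "?b\<^sup>2 / ?c \<le> ?a" using quad[of "- ?b / ?c"] by linarith
    then show ?thesis using c by (simp add: field_simps)
  qed
qed

lemma scalar_prod_self_nonneg: "(v :: real vec) \<bullet> v \<ge> 0"
  by (simp add: scalar_prod_def sum_nonneg)

lemma psd_mat_one: "psd_mat d (1\<^sub>m d)"
  by (auto simp: psd_mat_def scalar_prod_self_nonneg)

lemma pd_mat_imp_psd_mat: "pd_mat d Q \<Longrightarrow> psd_mat d Q"
  unfolding pd_mat_def psd_mat_def
  by (metis less_eq_real_def mult_mat_vec_carrier scalar_prod_left_zero)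

text \<open>Cauchy-Schwarz on each row; the constant is the squared Frobenius norm of
  \<open>M\<close>. Bounds stay in squared form until \<open>vnorm\<close> brings in the square
  root.\<close>

lemma mult_mat_vec_sq_bound:
  assumes M: "M \<in> carrier_mat r c"
  shows "\<exists>k\<ge>0. \<forall>v\<in>carrier_vec c. (M *\<^sub>v v) \<bullet> (M *\<^sub>v v) \<le> k * (v \<bullet> (v :: real vec))"
proof (intro exI conjI ballI)
  show "0 \<le> (\<Sum>i<r. row M i \<bullet> row M i)" by (simp add: sum_nonneg scalar_prod_self_nonneg)
  fix v :: "real vec" assume v: "v \<in> carrier_vec c"
  have "(M *\<^sub>v v) \<bullet> (M *\<^sub>v v) = (\<Sum>i<r. (row M i \<bullet> v)\<^sup>2)"
    using M by (simp add: scalar_prod_def[of "M *\<^sub>v v"] power2_eq_square atLeast0LessThan)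
  also have "\<dots> \<le> (\<Sum>i<r. (row M i \<bullet> row M i) * (v \<bullet> v))"
  proof (rule sum_mono)
    fix i assume "i \<in> {..<r}"
    then have "row M i \<in> carrier_vec c" using M by auto
    then show "(row M i \<bullet> v)\<^sup>2 \<le> (row M i \<bullet> row M i) * (v \<bullet> v)"
      using psd_mat_cauchy_schwarz[OF psd_mat_one _ v, of "row M i"] v by simp
  qed
  finally show "(M *\<^sub>v v) \<bullet> (M *\<^sub>v v) \<le> (\<Sum>i<r. row M i \<bullet> row M i) * (v \<bullet> v)"
    by (simp add: sum_distrib_right)
qed

text \<open>Stated for \<open>mat_inverse\<close> itself because the gain is given as
  \<open>Y * the (mat_inverse P)\<close>: the option has to be \<open>Some\<close>.\<close>

lemma mat_inverse_of_inj:
  fixes M :: "real mat"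
  assumes M: "M \<in> carrier_mat d d"
    and inj: "\<And>v. v \<in> carrier_vec d \<Longrightarrow> M *\<^sub>v v = 0\<^sub>v d \<Longrightarrow> v = 0\<^sub>v d"
  obtains S where "mat_inverse M = Some S" "S \<in> carrier_mat d d" "M * S = 1\<^sub>m d" "S * M = 1\<^sub>m d"
proof -
  have "det M \<noteq> 0" using inj det_0_iff_vec_prod_zero_field[OF M] by blast
  from det_non_zero_imp_unit[OF M this, where b = "()"] mat_inverse(1)[OF M, where b = "()"]
  obtain S where S: "mat_inverse M = Some S" by (cases "mat_inverse M") auto
  from mat_inverse(2)[OF M S] S that show ?thesis by blast
qed

lemma pd_mat_inverse:
  assumes Q: "pd_mat d Q"
  obtains S where "mat_inverse Q = Some S" "S \<in> carrier_mat d d" "Q * S = 1\<^sub>m d" "S * Q = 1\<^sub>m d"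
proof -
  have Qc: "Q \<in> carrier_mat d d" using Q by (simp add: pd_mat_def)
  have "v = 0\<^sub>v d" if "v \<in> carrier_vec d" "Q *\<^sub>v v = 0\<^sub>v d" for v
    using Q that unfolding pd_mat_def by (metis less_irrefl scalar_prod_right_zero)
  from mat_inverse_of_inj[OF Qc this] that show ?thesis by blast
qed

text \<open>Coercivity without eigenvalues: with \<open>S\<close> the inverse of \<open>Q\<close>,
  the coordinate \<open>v $ i\<close> is the \<open>Q\<close>-inner product of \<open>v\<close> with
  column \<open>i\<close> of \<open>S\<close>, so Cauchy-Schwarz for \<open>Q\<close> bounds it. The
  constant \<open>?k\<close> is the trace of \<open>S\<close>.\<close>

lemma pd_mat_sq_bound:
  assumes Q: "pd_mat d Q"
  shows "\<exists>k\<ge>0. \<forall>v\<in>carrier_vec d. v \<bullet> v \<le> k * (v \<bullet> (Q *\<^sub>v v))"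
proof -
  obtain S where S: "S \<in> carrier_mat d d" and QS: "Q * S = 1\<^sub>m d" using pd_mat_inverse[OF Q] by blast
  have Qc: "Q \<in> carrier_mat d d" using Q by (simp add: pd_mat_def)
  note psd = pd_mat_imp_psd_mat[OF Q]
  let ?k = "\<Sum>i<d. col S i \<bullet> (Q *\<^sub>v col S i)"
  show ?thesis
  proof (intro exI[of _ ?k] conjI ballI)
    show "0 \<le> ?k" using psd S by (auto simp: psd_mat_def intro!: sum_nonneg)
    fix v :: "real vec" assume v: "v \<in> carrier_vec d"
    have "v \<bullet> v = (\<Sum>i<d. (v $ i)\<^sup>2)"
      using v by (simp add: scalar_prod_def power2_eq_square atLeast0LessThan)
    also have "\<dots> \<le> (\<Sum>i<d. (v \<bullet> (Q *\<^sub>v v)) * (col S i \<bullet> (Q *\<^sub>v col S i)))"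
    proof (rule sum_mono)
      fix i assume "i \<in> {..<d}"
      then have i: "i < d" by simp
      have "Q *\<^sub>v col S i = unit_vec d i"
        using col_mult2[OF Qc S i] QS i by simp
      then have "v $ i = v \<bullet> (Q *\<^sub>v col S i)" using v i by simp
      then show "(v $ i)\<^sup>2 \<le> (v \<bullet> (Q *\<^sub>v v)) * (col S i \<bullet> (Q *\<^sub>v col S i))"
        using psd_mat_cauchy_schwarz[OF psd v, of "col S i"] S i by simp
    qed
    finally show "v \<bullet> v \<le> ?k * (v \<bullet> (Q *\<^sub>v v))"
      by (simp add: sum_distrib_left mult.commute)
  qed
qed

lemma scalar_prod_self_eq_0:
  "(v :: real vec) \<in> carrier_vec d \<Longrightarrow> v \<bullet> v = 0 \<Longrightarrow> v = 0\<^sub>v d"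
  by (intro eq_vecI) (auto simp: scalar_prod_def sum_nonneg_eq_0_iff)

text \<open>Turns the rank condition of observability into a matrix to multiply with, the
  pseudoinverse \<open>(M^T M)^-1 M^T\<close>; it exists because the Gram matrix has the same kernel
  as \<open>M\<close>.\<close>

lemma full_column_rank_left_inverse:
  fixes M :: "real mat"
  assumes M: "M \<in> carrier_mat r c" and rk: "vec_space.rank r M = c"
  obtains J where "J \<in> carrier_mat c r" "J * M = 1\<^sub>m c"
proof -
  interpret vec_space "TYPE(real)" r .
  \<comment> \<open>\<open>lin_indpt\<close> speaks of the set of columns and would not notice a
    repeated one; rank \<open>c\<close> forces \<open>c\<close> different columns.\<close>
  have "distinct (cols M)"
  proof -
    obtain S where S: "maximal S (\<lambda>T. T \<subseteq> set (cols M) \<and> lin_indpt T)"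
      using maximal_exists[of "(\<lambda>T. T \<subseteq> set (cols M) \<and> lin_indpt T)" "card (set (cols M))" "{}"]
      by (meson List.finite_set card_mono empty_iff empty_subsetI finite_lin_indpt2 rev_finite_subset)
    then have "card S \<le> card (set (cols M))" by (simp add: card_mono maximal_def)
    then have "length (cols M) \<le> card (set (cols M))"
      using rank_card_indpt[OF M S] rk M by simp
    then show ?thesis by (intro card_distinct le_antisym card_length)
  qed
  then have inj: "v = 0\<^sub>v c" if "v \<in> carrier_vec c" "M *\<^sub>v v = 0\<^sub>v r" for v
    using full_rank_lin_indpt[OF M rk] lin_depI[OF M that(1) _ that(2)] by blast
  let ?G = "transpose_mat M * M"
  have G: "?G \<in> carrier_mat c c" using M by simp
  have "v = 0\<^sub>v c" if v: "v \<in> carrier_vec c" and 0: "?G *\<^sub>v v = 0\<^sub>v c" for v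
  proof -
    have "(M *\<^sub>v v) \<bullet> (M *\<^sub>v v) = (transpose_mat M *\<^sub>v (M *\<^sub>v v)) \<bullet> v"
      using transpose_vec_mult_scalar[OF M v, of "M *\<^sub>v v"] M v by simp
    also have "transpose_mat M *\<^sub>v (M *\<^sub>v v) = ?G *\<^sub>v v"
      using assoc_mult_mat_vec[of "transpose_mat M" c r M c v] M v by simp
    finally have "M *\<^sub>v v = 0\<^sub>v r" using 0 v M by (intro scalar_prod_self_eq_0) auto
    then show ?thesis using inj v by blast
  qed
  from mat_inverse_of_inj[OF G this] obtain S where
    S: "S \<in> carrier_mat c c" "S * ?G = 1\<^sub>m c" by metis
  show ?thesis
  proof
    show "S * transpose_mat M \<in> carrier_mat c r" using S M by simp
    show "S * transpose_mat M * M = 1\<^sub>m c"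
      using S M assoc_mult_mat[of S c c "transpose_mat M" r M c] by simp
  qed
qed

section \<open>State reconstruction from a window of data\<close>

lemma stackv_dim [simp]: "dim_vec (stackv q f s l) = q * l" "stackv q f s l \<in> carrier_vec (q * l)"
  by (auto simp: stackv_def)

lemma block_index_less: "i < (l::nat) \<Longrightarrow> r < q \<Longrightarrow> q * i + r < q * l"
proof -
  assume "i < l" "r < q"
  then have "q * i + r < q * Suc i" by simp
  also have "\<dots> \<le> q * l" using \<open>i < l\<close> by (intro mult_le_mono2) simp
  finally show ?thesis .
qed

lemma stackv_index: "i < l \<Longrightarrow> r < q \<Longrightarrow> stackv q f s l $ (q * i + r) = f (s + i) $ r"
  by (simp add: stackv_def block_index_less)

lemma div_mod_less:
  assumes "i < q * (l::nat)" shows "i div q < l" "i mod q < q"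
proof -
  have "q > 0" using assms by (cases q) auto
  then show "i div q < l" "i mod q < q" using assms by (auto simp: less_mult_imp_div_less mult.commute)
qed

text \<open>Extraction of entries from a window, as a matrix so that it composes with the system
  matrices. A single input block, the output half of a window and the transpose of
  \<open>L_mat\<close> are all instances.\<close>

definition select_mat :: "nat \<Rightarrow> nat \<Rightarrow> (nat \<Rightarrow> nat) \<Rightarrow> real mat" where
  "select_mat r c f = mat r c (\<lambda>(i,j). if j = f i then 1 else 0)"

lemma select_mat_carrier [simp]: "select_mat r c f \<in> carrier_mat r c"
  by (simp add: select_mat_def)

lemma select_mat_mult_vec:
  assumes "w \<in> carrier_vec c" "\<And>i. i < r \<Longrightarrow> f i < c"
  shows "select_mat r c f *\<^sub>v w = vec r (\<lambda>i. w $ f i)"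
proof (intro eq_vecI)
  fix i assume "i < dim_vec (vec r (\<lambda>i. w $ f i))"
  then have i: "i < r" by simp
  then have "row (select_mat r c f) i = unit_vec c (f i)"
    using assms(2)[OF i] by (intro eq_vecI) (auto simp: select_mat_def)
  then show "(select_mat r c f *\<^sub>v w) $ i = vec r (\<lambda>i. w $ f i) $ i"
    using i assms by (simp add: select_mat_def)
qed (simp add: select_mat_def)

text \<open>\<open>obs_mat\<close> is the instance with blocks \<open>C * A ^\<^sub>m i\<close>; the
  stacked forced responses \<open>C * G i\<close> are another.\<close>

definition block_rows :: "nat \<Rightarrow> nat \<Rightarrow> nat \<Rightarrow> (nat \<Rightarrow> real mat) \<Rightarrow> real mat" where
  "block_rows q l c M = mat (q * l) c (\<lambda>(i,j). M (i div q) $$ (i mod q, j))"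

lemma block_rows_carrier [simp]: "block_rows q l c M \<in> carrier_mat (q * l) c"
  by (simp add: block_rows_def)

lemma block_rows_mult_vec:
  assumes M: "\<And>i. i < l \<Longrightarrow> M i \<in> carrier_mat q c" and v: "v \<in> carrier_vec c"
  shows "block_rows q l c M *\<^sub>v v = stackv q (\<lambda>i. M i *\<^sub>v v) 0 l"
proof (intro eq_vecI)
  fix i assume "i < dim_vec (stackv q (\<lambda>i. M i *\<^sub>v v) 0 l)"
  then have i: "i < q * l" by simp
  note dm = div_mod_less[OF i]
  have "row (block_rows q l c M) i = row (M (i div q)) (i mod q)"
    using i dm M[OF dm(1)] by (intro eq_vecI) (auto simp: block_rows_def)
  then show "(block_rows q l c M *\<^sub>v v) $ i = stackv q (\<lambda>i. M i *\<^sub>v v) 0 l $ i"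
    using i dm M[OF dm(1)] by (simp add: block_rows_def stackv_def)
qed (simp add: block_rows_def)

text \<open>The library power appends its factor on the right, whereas the state recursion
  multiplies by \<open>A\<close> on the left.\<close>

lemma pow_mat_Suc_left:
  fixes A :: "'a :: semiring_1 mat"
  assumes A: "A \<in> carrier_mat n n"
  shows "A ^\<^sub>m Suc i = A * A ^\<^sub>m i"
proof (induction i)
  case (Suc i)
  have "A ^\<^sub>m Suc (Suc i) = (A * A ^\<^sub>m i) * A" using Suc by simp
  also have "\<dots> = A * A ^\<^sub>m Suc i"
    using A pow_carrier_mat[OF A, of i] by (simp add: assoc_mult_mat[of A n n _ n _ n])
  finally show ?case .
qed (use A in simp)

text \<open>Variation of constants: \<open>G\<close> applied to the window is the response forced by
  the inputs. It acts on the full window of length \<open>l\<close> for every \<open>i\<close>, so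
  that the responses can be stacked later, and it is chosen before \<open>x\<close>,
  \<open>u\<close> and \<open>k\<close>, so that one matrix serves all trajectories.\<close>

lemma state_affine_in_window:
  fixes A B C :: "real mat"
  assumes A: "A \<in> carrier_mat n n" and B: "B \<in> carrier_mat n m"
  shows "i \<le> l \<Longrightarrow> \<exists>G \<in> carrier_mat n (p*l + m*l). \<forall>x u k. x k \<in> carrier_vec n \<longrightarrow>
      (\<forall>j<i. u (k + j) \<in> carrier_vec m \<and> x (Suc (k + j)) = A *\<^sub>v x (k + j) + B *\<^sub>v u (k + j)) \<longrightarrow>
      x (k + i) = A ^\<^sub>m i *\<^sub>v x k + G *\<^sub>v (stackv p (\<lambda>j. C *\<^sub>v x j) k l @\<^sub>v stackv m u k l)"
proof (induction i)
  case 0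
  show ?case
    using A by (intro bexI[of _ "0\<^sub>m n (p*l + m*l)"]) auto
next
  case (Suc i)
  let ?N = "p*l + m*l"
  from Suc obtain G where G: "G \<in> carrier_mat n ?N" and
    IH: "\<And>x u k. x k \<in> carrier_vec n \<Longrightarrow>
      (\<forall>j<i. u (k + j) \<in> carrier_vec m \<and> x (Suc (k + j)) = A *\<^sub>v x (k + j) + B *\<^sub>v u (k + j)) \<Longrightarrow>
      x (k + i) = A ^\<^sub>m i *\<^sub>v x k + G *\<^sub>v (stackv p (\<lambda>j. C *\<^sub>v x j) k l @\<^sub>v stackv m u k l)"
    by auto
  \<comment> \<open>\<open>p*l\<close> skips the output half of the window, \<open>m*i\<close> the
    inputs before time \<open>k + i\<close>.\<close>
  define E where "E = select_mat m ?N (\<lambda>r. p*l + (m*i + r))"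
  have E: "E \<in> carrier_mat m ?N" by (simp add: E_def)
  show ?case
  proof (intro bexI[of _ "A * G + B * E"] allI impI)
    show "A * G + B * E \<in> carrier_mat n ?N" using A G B E by auto
    fix x u k
    assume x: "x k \<in> carrier_vec n" and dyn: "\<forall>j<Suc i. u (k + j) \<in> carrier_vec m \<and>
      x (Suc (k + j)) = A *\<^sub>v x (k + j) + B *\<^sub>v u (k + j)"
    define w where "w = stackv p (\<lambda>j. C *\<^sub>v x j) k l @\<^sub>v stackv m u k l"
    have w: "w \<in> carrier_vec ?N" by (simp add: w_def)
    have "E *\<^sub>v w = u (k + i)"
    proof (intro eq_vecI)
      fix r assume "r < dim_vec (u (k + i))"
      then have r: "r < m" using dyn by auto
      have "E *\<^sub>v w = vec m (\<lambda>r. w $ (p*l + (m*i + r)))"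
        unfolding E_def using w Suc.prems
        by (intro select_mat_mult_vec) (auto intro: block_index_less)
      then show "(E *\<^sub>v w) $ r = u (k + i) $ r"
        using r Suc.prems by (simp add: w_def stackv_index block_index_less)
    qed (use dyn E in auto)
    moreover have "x (k + i) = A ^\<^sub>m i *\<^sub>v x k + G *\<^sub>v w" unfolding w_def using dyn x by (intro IH) auto
    ultimately have "x (k + Suc i) = A *\<^sub>v (A ^\<^sub>m i *\<^sub>v x k + G *\<^sub>v w) + B *\<^sub>v (E *\<^sub>v w)"
      using dyn by simp
    also have "\<dots> = A *\<^sub>v (A ^\<^sub>m i *\<^sub>v x k) + (A *\<^sub>v (G *\<^sub>v w) + B *\<^sub>v (E *\<^sub>v w))"
      using A B G E w mult_mat_vec_carrier[OF pow_carrier_mat[OF A] x, of i]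
      by (subst mult_add_distrib_mat_vec[of _ n n]) (auto intro: assoc_add_vec)
    also have "A *\<^sub>v (A ^\<^sub>m i *\<^sub>v x k) = A ^\<^sub>m Suc i *\<^sub>v x k"
      using A x pow_carrier_mat[OF A, of i]
      by (simp only: pow_mat_Suc_left[OF A] assoc_mult_mat_vec[of A n n "A ^\<^sub>m i" n])
    also have "A *\<^sub>v (G *\<^sub>v w) + B *\<^sub>v (E *\<^sub>v w) = (A * G + B * E) *\<^sub>v w"
      using A B G E w by (simp add: add_mult_distrib_mat_vec[of _ n ?N] assoc_mult_mat_vec[of _ n n]
          assoc_mult_mat_vec[of _ n m])
    finally show "x (k + Suc i) = A ^\<^sub>m Suc i *\<^sub>v x k +
        (A * G + B * E) *\<^sub>v (stackv p (\<lambda>j. C *\<^sub>v x j) k l @\<^sub>v stackv m u k l)"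
      by (simp add: w_def)
  qed
qed

text \<open>Subtracting the forced responses from the outputs leaves the observability matrix
  applied to \<open>x k\<close>. Its left inverse recovers \<open>x k\<close>, and running the plant
  over the window gives \<open>x (k + l)\<close>. Hence \<open>R = A^l J H + G l\<close>, where
  \<open>H\<close> maps a window to its free response.\<close>

lemma observable_state_from_window:
  fixes A B C :: "real mat"
  assumes A: "A \<in> carrier_mat n n" and B: "B \<in> carrier_mat n m" and C: "C \<in> carrier_mat p n"
    and rk: "obs_rank C A l = n"
  shows "\<exists>R \<in> carrier_mat n (p*l + m*l). \<forall>x u k. x k \<in> carrier_vec n \<longrightarrow>
      (\<forall>j<l. u (k + j) \<in> carrier_vec m \<and> x (Suc (k + j)) = A *\<^sub>v x (k + j) + B *\<^sub>v u (k + j)) \<longrightarrow>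
      x (k + l) = R *\<^sub>v (stackv p (\<lambda>j. C *\<^sub>v x j) k l @\<^sub>v stackv m u k l)"
proof -
  let ?N = "p*l + m*l"
  \<comment> \<open>Naming the property closes the quantifiers over trajectories, so that
    \<open>bchoice\<close> selects a family \<open>G\<close> depending on \<open>i\<close>
    only.\<close>
  define aff where "aff i G \<longleftrightarrow> (\<forall>x u k. x k \<in> carrier_vec n \<longrightarrow>
      (\<forall>j<i. u (k + j) \<in> carrier_vec m \<and> x (Suc (k + j)) = A *\<^sub>v x (k + j) + B *\<^sub>v u (k + j)) \<longrightarrow>
      x (k + i) = A ^\<^sub>m i *\<^sub>v x k + G *\<^sub>v (stackv p (\<lambda>j. C *\<^sub>v x j) k l @\<^sub>v stackv m u k l))" for i G
  have "\<forall>i\<in>{..l}. \<exists>G. G \<in> carrier_mat n ?N \<and> aff i G"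
    using state_affine_in_window[OF A B, of _ l p C] unfolding aff_def Bex_def by blast
  from bchoice[OF this] obtain G where G: "\<And>i. i \<le> l \<Longrightarrow> G i \<in> carrier_mat n ?N"
    and aff: "\<And>i. i \<le> l \<Longrightarrow> aff i (G i)" by auto
  have xG: "x (k + i) = A ^\<^sub>m i *\<^sub>v x k + G i *\<^sub>v (stackv p (\<lambda>j. C *\<^sub>v x j) k l @\<^sub>v stackv m u k l)"
    if "i \<le> l" "x k \<in> carrier_vec n"
      "\<forall>j<i. u (k + j) \<in> carrier_vec m \<and> x (Suc (k + j)) = A *\<^sub>v x (k + j) + B *\<^sub>v u (k + j)"
    for i x u k
    using aff[OF that(1)] that(2,3) unfolding aff_def by blast
  have O: "obs_mat C A l = block_rows p l n (\<lambda>i. C * A ^\<^sub>m i)"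
    using A C by (simp add: obs_mat_def block_rows_def)
  define Ob where "Ob = block_rows p l n (\<lambda>i. C * A ^\<^sub>m i)"
  have Obc: "Ob \<in> carrier_mat (p*l) n" by (simp add: Ob_def)
  obtain J where J: "J \<in> carrier_mat n (p*l)" and JO: "J * Ob = 1\<^sub>m n"
    using full_column_rank_left_inverse[of Ob "p*l" n] rk C O Obc by (auto simp: obs_rank_def Ob_def)
  define H where "H = select_mat (p*l) ?N (\<lambda>i. i) - block_rows p l ?N (\<lambda>i. C * G i)"
  have Hc: "H \<in> carrier_mat (p*l) ?N" by (auto simp: H_def intro: minus_carrier_mat)
  have Al: "A ^\<^sub>m l \<in> carrier_mat n n" using A by simp
  note Gl = G[of l, simplified]
  show ?thesis
  proof (intro bexI[of _ "A ^\<^sub>m l * (J * H) + G l"] allI impI)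
    show "A ^\<^sub>m l * (J * H) + G l \<in> carrier_mat n ?N" using Al J Hc Gl by auto
    fix x :: "nat \<Rightarrow> real vec" and u k
    assume x: "x k \<in> carrier_vec n" and dyn: "\<forall>j<l. u (k + j) \<in> carrier_vec m \<and>
      x (Suc (k + j)) = A *\<^sub>v x (k + j) + B *\<^sub>v u (k + j)"
    define w where "w = stackv p (\<lambda>j. C *\<^sub>v x j) k l @\<^sub>v stackv m u k l"
    have w: "w \<in> carrier_vec ?N" by (simp add: w_def)
    have "Ob *\<^sub>v x k = H *\<^sub>v w"
    proof (intro eq_vecI)
      fix q assume "q < dim_vec (H *\<^sub>v w)"
      then have q: "q < p * l" using Hc by simp
      note dm = div_mod_less[OF q]
      let ?i = "q div p" and ?r = "q mod p"
      have Gi: "G ?i \<in> carrier_mat n ?N" using G dm by simp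
      have Ai: "A ^\<^sub>m ?i \<in> carrier_mat n n" using A by simp
      have "x (k + ?i) = A ^\<^sub>m ?i *\<^sub>v x k + G ?i *\<^sub>v w"
        unfolding w_def using dm dyn x by (intro xG) auto
      then have y: "C *\<^sub>v x (k + ?i) = (C * A ^\<^sub>m ?i) *\<^sub>v x k + (C * G ?i) *\<^sub>v w"
        using C x w Gi Ai by (simp add: mult_add_distrib_mat_vec[of _ p n] assoc_mult_mat_vec[of _ p n])
      have "(Ob *\<^sub>v x k) $ q = ((C * A ^\<^sub>m ?i) *\<^sub>v x k) $ ?r"
        unfolding Ob_def using x C A q dm by (subst block_rows_mult_vec) (auto simp: stackv_def)
      moreover have "(H *\<^sub>v w) $ q = (C *\<^sub>v x (k + ?i)) $ ?r - ((C * G ?i) *\<^sub>v w) $ ?r"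
      proof -
        have "H *\<^sub>v w = vec (p*l) (\<lambda>i. w $ i) - stackv p (\<lambda>i. (C * G i) *\<^sub>v w) 0 l"
          unfolding H_def using w C G
          by (subst minus_mult_distrib_mat_vec[of _ "p*l" ?N])
             (auto simp: select_mat_mult_vec block_rows_mult_vec)
        then show ?thesis using q dm by (simp add: stackv_def w_def)
      qed
      ultimately show "(Ob *\<^sub>v x k) $ q = (H *\<^sub>v w) $ q"
        using y dm C by simp
    qed (use Obc Hc in auto)
    then have "(J * Ob) *\<^sub>v x k = (J * H) *\<^sub>v w"
      by (simp only: assoc_mult_mat_vec[OF J Obc x] assoc_mult_mat_vec[OF J Hc w])
    then have xk: "x k = (J * H) *\<^sub>v w" using JO x by simp
    have "x (k + l) = A ^\<^sub>m l *\<^sub>v x k + G l *\<^sub>v w"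
      unfolding w_def using dyn x by (intro xG) auto
    also have "\<dots> = (A ^\<^sub>m l * (J * H) + G l) *\<^sub>v w"
      unfolding xk
      by (simp only: add_mult_distrib_mat_vec[OF mult_carrier_mat[OF Al mult_carrier_mat[OF J Hc]] Gl w]
          assoc_mult_mat_vec[OF Al mult_carrier_mat[OF J Hc] w])
    finally show "x (k + l) = (A ^\<^sub>m l * (J * H) + G l) *\<^sub>v
        (stackv p (\<lambda>j. C *\<^sub>v x j) k l @\<^sub>v stackv m u k l)"
      by (simp add: w_def)
  qed
qed

section \<open>The linear matrix inequality and the data inequality\<close>

lemma scalar_prod_mult_transpose:
  fixes M :: "'a :: comm_semiring_0 mat"
  assumes "M \<in> carrier_mat r c" "a \<in> carrier_vec r" "b \<in> carrier_vec c"
  shows "a \<bullet> (M *\<^sub>v b) = (transpose_mat M *\<^sub>v a) \<bullet> b"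
  using transpose_vec_mult_scalar[of M r c b a] assms by simp

lemma append_vec_empty: "v @\<^sub>v vNil = v"
  by (intro eq_vecI) auto

lemma block3_mult_vec:
  assumes M: "M11 \<in> carrier_mat d d" "M12 \<in> carrier_mat d d" "M13 \<in> carrier_mat d d"
    "M21 \<in> carrier_mat d d" "M22 \<in> carrier_mat d d" "M23 \<in> carrier_mat d d"
    "M31 \<in> carrier_mat d d" "M32 \<in> carrier_mat d d" "M33 \<in> carrier_mat d d"
    and abc: "a \<in> carrier_vec d" "b \<in> carrier_vec d" "c \<in> carrier_vec d"
  shows "block3 M11 M12 M13 M21 M22 M23 M31 M32 M33 *\<^sub>v (a @\<^sub>v (b @\<^sub>v c)) =
    (M11 *\<^sub>v a + (M12 *\<^sub>v b + M13 *\<^sub>v c)) @\<^sub>v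
    ((M21 *\<^sub>v a + (M22 *\<^sub>v b + M23 *\<^sub>v c)) @\<^sub>v (M31 *\<^sub>v a + (M32 *\<^sub>v b + M33 *\<^sub>v c)))"
proof -
  let ?UR = "four_block_mat M12 M13 (0\<^sub>m 0 d) (0\<^sub>m 0 d)"
  let ?LL = "four_block_mat M21 (0\<^sub>m d 0) M31 (0\<^sub>m d 0)"
  let ?LR = "four_block_mat M22 M23 M32 M33"
  have UR: "?UR \<in> carrier_mat d (d + d)"
    using four_block_carrier_mat[of M12 d d "0\<^sub>m 0 d" 0 d M13 "0\<^sub>m 0 d"] M by simp
  have LL: "?LL \<in> carrier_mat (d + d) d"
    using four_block_carrier_mat[of M21 d d "0\<^sub>m d 0" d 0 "0\<^sub>m d 0" M31] M by simp
  have LR: "?LR \<in> carrier_mat (d + d) (d + d)" using M by simp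
  have "?UR *\<^sub>v (b @\<^sub>v c) = (M12 *\<^sub>v b + M13 *\<^sub>v c) @\<^sub>v (0\<^sub>m 0 d *\<^sub>v b + 0\<^sub>m 0 d *\<^sub>v c)"
    using M abc by (intro four_block_mat_mult_vec) auto
  also have "0\<^sub>m 0 d *\<^sub>v b + 0\<^sub>m 0 d *\<^sub>v c = 0\<^sub>v 0" by (intro eq_vecI) auto
  finally have URv: "?UR *\<^sub>v (b @\<^sub>v c) = M12 *\<^sub>v b + M13 *\<^sub>v c" by (simp add: append_vec_empty)
  \<comment> \<open>\<open>block3\<close> pads its outer off-diagonal blocks with matrices without
    rows or columns; an empty vector is appended to \<open>a\<close> to match that
    splitting.\<close>
  have "?LL *\<^sub>v (a @\<^sub>v 0\<^sub>v 0) = (M21 *\<^sub>v a + 0\<^sub>m d 0 *\<^sub>v 0\<^sub>v 0) @\<^sub>v (M31 *\<^sub>v a + 0\<^sub>m d 0 *\<^sub>v 0\<^sub>v 0)"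
    using M abc by (intro four_block_mat_mult_vec) auto
  also have "0\<^sub>m d 0 *\<^sub>v 0\<^sub>v 0 = (0\<^sub>v d :: real vec)" by (intro eq_vecI) (auto simp: scalar_prod_def)
  finally have LLv: "?LL *\<^sub>v a = (M21 *\<^sub>v a) @\<^sub>v (M31 *\<^sub>v a)" using M abc by (simp add: append_vec_empty)
  have LRv: "?LR *\<^sub>v (b @\<^sub>v c) = (M22 *\<^sub>v b + M23 *\<^sub>v c) @\<^sub>v (M32 *\<^sub>v b + M33 *\<^sub>v c)"
    using M abc by (intro four_block_mat_mult_vec) auto
  have "four_block_mat M11 ?UR ?LL ?LR *\<^sub>v (a @\<^sub>v (b @\<^sub>v c)) =
      (M11 *\<^sub>v a + ?UR *\<^sub>v (b @\<^sub>v c)) @\<^sub>v (?LL *\<^sub>v a + ?LR *\<^sub>v (b @\<^sub>v c))"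
    using M(1) UR LL LR abc by (intro four_block_mat_mult_vec) auto
  also have "?LL *\<^sub>v a + ?LR *\<^sub>v (b @\<^sub>v c) =
      (M21 *\<^sub>v a + (M22 *\<^sub>v b + M23 *\<^sub>v c)) @\<^sub>v (M31 *\<^sub>v a + (M32 *\<^sub>v b + M33 *\<^sub>v c))"
    unfolding LLv LRv using M abc by (intro append_vec_add[of _ d _ _ d]) auto
  finally show ?thesis unfolding block3_def URv using M by simp
qed

lemma append_vec_eq_zero:
  assumes "a \<in> carrier_vec r" "b \<in> carrier_vec c" "a @\<^sub>v b = 0\<^sub>v (r + c)"
  shows "a = 0\<^sub>v r" "b = 0\<^sub>v c"
proof -
  have "0\<^sub>v (r + c) = 0\<^sub>v r @\<^sub>v 0\<^sub>v c" by (intro eq_vecI) auto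
  with assms(3) have "a @\<^sub>v b = 0\<^sub>v r @\<^sub>v 0\<^sub>v c" by (rule trans)
  then show "a = 0\<^sub>v r" "b = 0\<^sub>v c" using append_vec_eq[OF assms(1) zero_carrier_vec] by blast+
qed

lemma nd_mat_neg:
  assumes nd: "nd_mat d M" and v: "v \<in> carrier_vec d" "v \<noteq> 0\<^sub>v d"
  shows "v \<bullet> (M *\<^sub>v v) < 0"
proof -
  have M: "M \<in> carrier_mat d d" and "0 < v \<bullet> (- M *\<^sub>v v)"
    using nd v unfolding nd_mat_def pd_mat_def by auto
  then show ?thesis using v by simp
qed

text \<open>The blocks built from data see \<open>a\<close> only through \<open>w\<close>. Together
  they contribute minus the quadratic form in \<open>(w, c)\<close> that the data keep nonpositive
  when \<open>c = - Z^T w\<close>. \<open>X\<close> stands for \<open>F P + Bl Y\<close>, and each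
  symmetric pair of off-diagonal blocks merges into a doubled term.\<close>

lemma lmi_quadratic_form:
  fixes P L CC X BB AA :: "real mat"
  assumes P: "P \<in> carrier_mat d d" "transpose_mat P = P"
    and L: "L \<in> carrier_mat d p" and CC: "CC \<in> carrier_mat p p" and X: "X \<in> carrier_mat d d"
    and BB: "BB \<in> carrier_mat p d" and AA: "AA \<in> carrier_mat d d"
    and nd: "nd_mat (3 * d) (block3 (- P - L * CC * transpose_mat L) X (L * BB)
       (transpose_mat X) (- P) (- P) (transpose_mat BB * transpose_mat L) (- P) (- AA))"
    and abc: "a \<in> carrier_vec d" "b \<in> carrier_vec d" "c \<in> carrier_vec d"
    and nz: "a \<noteq> 0\<^sub>v d \<or> b \<noteq> 0\<^sub>v d" and w: "w = transpose_mat L *\<^sub>v a"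
  shows "- (a \<bullet> (P *\<^sub>v a)) - w \<bullet> (CC *\<^sub>v w) + 2 * (a \<bullet> (X *\<^sub>v b)) + 2 * (w \<bullet> (BB *\<^sub>v c))
      - b \<bullet> (P *\<^sub>v b) - 2 * (b \<bullet> (P *\<^sub>v c)) - c \<bullet> (AA *\<^sub>v c) < 0"
proof -
  let ?M = "block3 (- P - L * CC * transpose_mat L) X (L * BB)
       (transpose_mat X) (- P) (- P) (transpose_mat BB * transpose_mat L) (- P) (- AA)"
  let ?v = "a @\<^sub>v (b @\<^sub>v c)"
  have M: "- P - L * CC * transpose_mat L \<in> carrier_mat d d" "L * BB \<in> carrier_mat d d"
    "transpose_mat BB * transpose_mat L \<in> carrier_mat d d" "- P \<in> carrier_mat d d" "- AA \<in> carrier_mat d d"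
    "transpose_mat X \<in> carrier_mat d d"
    using P L CC BB AA X by (auto intro!: minus_carrier_mat)
  have v: "?v \<in> carrier_vec (3 * d)"
    using abc append_carrier_vec[of a d "b @\<^sub>v c" "d + d"] by (simp add: numeral_3_eq_3 add.assoc)
  have "?v \<noteq> 0\<^sub>v (3 * d)"
  proof
    assume "?v = 0\<^sub>v (3 * d)"
    then have "?v = 0\<^sub>v (d + (d + d))" by (simp add: numeral_3_eq_3 add.assoc)
    then show False
      using append_vec_eq_zero[of a d "b @\<^sub>v c" "d + d"] append_vec_eq_zero[of b d c d] abc nz by auto
  qed
  then have neg: "?v \<bullet> (?M *\<^sub>v ?v) < 0" by (rule nd_mat_neg[OF nd v])
  have wc: "w \<in> carrier_vec p" using w L abc by simp
  have lc: "a \<bullet> ((L * M) *\<^sub>v y) = w \<bullet> (M *\<^sub>v y)" if "M \<in> carrier_mat p k" "y \<in> carrier_vec k" for M y k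
    using scalar_prod_mult_transpose[of L d p a "M *\<^sub>v y"] L abc that
    by (simp add: assoc_mult_mat_vec[of L d p M k y] w)
  have "(L * CC * transpose_mat L) *\<^sub>v a = (L * CC) *\<^sub>v w"
    unfolding w using L by (intro assoc_mult_mat_vec[OF mult_carrier_mat[OF L CC] _ abc(1)]) simp
  then have 1: "a \<bullet> ((- P - L * CC * transpose_mat L) *\<^sub>v a) = - (a \<bullet> (P *\<^sub>v a)) - w \<bullet> (CC *\<^sub>v w)"
    using lc[OF CC wc] P L CC abc
    by (simp add: minus_mult_distrib_mat_vec[of _ d d] scalar_prod_minus_distrib[of _ d] wc)
  have 2: "b \<bullet> (transpose_mat X *\<^sub>v a) = a \<bullet> (X *\<^sub>v b)"
    using scalar_prod_mult_transpose[OF X abc(1,2)] X abc comm_scalar_prod[of b d "transpose_mat X *\<^sub>v a"] by simp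
  have 3: "c \<bullet> ((transpose_mat BB * transpose_mat L) *\<^sub>v a) = w \<bullet> (BB *\<^sub>v c)"
    using scalar_prod_mult_transpose[OF BB wc abc(3)] BB L abc comm_scalar_prod[of c d "transpose_mat BB *\<^sub>v w"] wc
    by (simp add: w assoc_mult_mat_vec[of _ d p])
  have 4: "c \<bullet> (P *\<^sub>v b) = b \<bullet> (P *\<^sub>v c)"
    using scalar_prod_mult_transpose[of P d d b c] P abc comm_scalar_prod[of c d "P *\<^sub>v b"] by simp
  have "?v \<bullet> (?M *\<^sub>v ?v) =
     (a \<bullet> ((- P - L * CC * transpose_mat L) *\<^sub>v a) + (a \<bullet> (X *\<^sub>v b) + a \<bullet> ((L * BB) *\<^sub>v c))) +
     ((b \<bullet> (transpose_mat X *\<^sub>v a) + (b \<bullet> ((- P) *\<^sub>v b) + b \<bullet> ((- P) *\<^sub>v c))) +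
      (c \<bullet> ((transpose_mat BB * transpose_mat L) *\<^sub>v a) + (c \<bullet> ((- P) *\<^sub>v b) + c \<bullet> ((- AA) *\<^sub>v c))))"
  proof -
    have s: "z \<bullet> (M1 *\<^sub>v a + (M2 *\<^sub>v b + M3 *\<^sub>v c)) = z \<bullet> (M1 *\<^sub>v a) + (z \<bullet> (M2 *\<^sub>v b) + z \<bullet> (M3 *\<^sub>v c))"
      if "z \<in> carrier_vec d" "M1 \<in> carrier_mat d d" "M2 \<in> carrier_mat d d" "M3 \<in> carrier_mat d d" for z M1 M2 M3
      using that abc by (simp add: scalar_prod_add_distrib[of _ d])
    show ?thesis
      unfolding block3_mult_vec[OF M(1) X M(2,6,4,4,3,4,5) abc]
      apply (subst scalar_prod_append[of a d "b @\<^sub>v c" "d + d"])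
          apply (use abc M X in \<open>auto intro!: append_carrier_vec\<close>)[4]
      apply (subst scalar_prod_append[of b d c d])
          apply (use abc M X in \<open>auto\<close>)[4]
      using s abc M X by presburger
  qed
  then show ?thesis
    using neg 1 2 3 4 lc[OF BB abc(3)] P AA abc by simp
qed

section \<open>The quadratic inequality encoded by the recorded data\<close>

lemma quadratic_form_Theta_split:
  assumes Th: "Th \<in> carrier_mat (p + d) (p + d)" "transpose_mat Th = Th"
    and w: "w \<in> carrier_vec p" and z: "z \<in> carrier_vec d"
  shows "(w @\<^sub>v z) \<bullet> (Th *\<^sub>v (w @\<^sub>v z)) =
    w \<bullet> (Th11 p Th *\<^sub>v w) + 2 * (w \<bullet> (Th12 p d Th *\<^sub>v z)) + z \<bullet> (Th22 p d Th *\<^sub>v z)"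
proof -
  have c: "Th11 p Th \<in> carrier_mat p p" "Th12 p d Th \<in> carrier_mat p d" "Th22 p d Th \<in> carrier_mat d d"
    by (auto simp: Th11_def Th12_def Th22_def)
  have sym: "Th $$ (i, j) = Th $$ (j, i)" if "i < p + d" "j < p + d" for i j
    using Th that by (metis carrier_matD index_transpose_mat(1))
  have "Th = four_block_mat (Th11 p Th) (Th12 p d Th) (transpose_mat (Th12 p d Th)) (Th22 p d Th)"
    using Th(1) by (intro eq_matI) (auto simp: Th11_def Th12_def Th22_def sym)
  then have "Th *\<^sub>v (w @\<^sub>v z) = (Th11 p Th *\<^sub>v w + Th12 p d Th *\<^sub>v z) @\<^sub>v
      (transpose_mat (Th12 p d Th) *\<^sub>v w + Th22 p d Th *\<^sub>v z)"
    using four_block_mat_mult_vec[OF c(1,2) _ c(3) w z, of "transpose_mat (Th12 p d Th)"] c by simp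
  moreover have "z \<bullet> (transpose_mat (Th12 p d Th) *\<^sub>v w) = w \<bullet> (Th12 p d Th *\<^sub>v z)"
    using scalar_prod_mult_transpose[OF c(2) w z] comm_scalar_prod[of z d "transpose_mat (Th12 p d Th) *\<^sub>v w"] c w z
    by simp
  ultimately show ?thesis
    using c w z by (simp add: scalar_prod_append[of _ p _ d] scalar_prod_add_distrib[of _ p] scalar_prod_add_distrib[of _ d])
qed

text \<open>With \<open>f = Psi1^T L w\<close>, \<open>g = Psi0^T z\<close> and
  \<open>q = (w, z)\<close>, the left-hand side is \<open>|f + g|^2 - q \<bullet> Th q\<close>; the
  minus sign inside the mixed block makes the cross term \<open>+ 2 f \<bullet> g\<close>. By
  \<open>residual\<close>, \<open>f + g = D^T q\<close>, so the total is the negative of the form of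
  \<open>Th - D D^T\<close> at \<open>q\<close>.\<close>

lemma data_consistency_inequality:
  fixes L Psi0 Psi1 Z Th D :: "real mat"
  assumes L: "L \<in> carrier_mat d p" and Psi: "Psi0 \<in> carrier_mat d M" "Psi1 \<in> carrier_mat d M"
    and Z: "Z \<in> carrier_mat p d" and Th: "Th \<in> carrier_mat (p + d) (p + d)" "transpose_mat Th = Th"
    and D: "D \<in> carrier_mat (p + d) M" and noise: "psd_mat (p + d) (Th - D * transpose_mat D)"
    and w: "w \<in> carrier_vec p" and z: "z \<in> carrier_vec d"
    and residual: "transpose_mat Psi1 *\<^sub>v (L *\<^sub>v w) + transpose_mat Psi0 *\<^sub>v z = transpose_mat D *\<^sub>v (w @\<^sub>v z)"
  shows "w \<bullet> ((transpose_mat L * Psi1 * transpose_mat Psi1 * L - Th11 p Th) *\<^sub>v w)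
    - 2 * (w \<bullet> ((- (transpose_mat L * Psi1 * transpose_mat Psi0) + Th12 p d Th) *\<^sub>v z))
    + z \<bullet> ((Psi0 * transpose_mat Psi0 - Th22 p d Th) *\<^sub>v z) \<le> 0"
proof -
  have c: "Th11 p Th \<in> carrier_mat p p" "Th12 p d Th \<in> carrier_mat p d" "Th22 p d Th \<in> carrier_mat d d"
    by (auto simp: Th11_def Th12_def Th22_def)
  define f where "f = transpose_mat Psi1 *\<^sub>v (L *\<^sub>v w)"
  define g where "g = transpose_mat Psi0 *\<^sub>v z"
  have fg: "f \<in> carrier_vec M" "g \<in> carrier_vec M" using Psi L w z by (auto simp: f_def g_def)
  have LPsi: "transpose_mat L * Psi1 \<in> carrier_mat p M" using L Psi by simp
  have wL: "w \<bullet> ((transpose_mat L * Psi1) *\<^sub>v y) = f \<bullet> y" if "y \<in> carrier_vec M" for y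
    using scalar_prod_mult_transpose[OF LPsi w that] L Psi w
    by (simp add: f_def transpose_mult[of _ p d _ M] assoc_mult_mat_vec[of _ M d])
  have "(transpose_mat L * Psi1 * transpose_mat Psi1 * L) *\<^sub>v w = (transpose_mat L * Psi1) *\<^sub>v f"
    using LPsi L Psi w
    by (simp only: f_def assoc_mult_mat_vec[of "transpose_mat L * Psi1 * transpose_mat Psi1" p d L p]
        assoc_mult_mat_vec[of "transpose_mat L * Psi1" p M "transpose_mat Psi1" d]
        mult_carrier_mat[of _ p M _ d] transpose_carrier_mat mult_mat_vec_carrier[of _ d p])
  then have 1: "w \<bullet> ((transpose_mat L * Psi1 * transpose_mat Psi1 * L - Th11 p Th) *\<^sub>v w)
      = f \<bullet> f - w \<bullet> (Th11 p Th *\<^sub>v w)"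
    using LPsi L Psi w c fg wL[OF fg(1)]
    by (subst minus_mult_distrib_mat_vec[of _ p p]) (auto simp: scalar_prod_minus_distrib[of _ p])
  have "(transpose_mat L * Psi1 * transpose_mat Psi0) *\<^sub>v z = (transpose_mat L * Psi1) *\<^sub>v g"
    using LPsi Psi z by (simp add: g_def assoc_mult_mat_vec[of "transpose_mat L * Psi1" p M _ d])
  then have 2: "w \<bullet> ((- (transpose_mat L * Psi1 * transpose_mat Psi0) + Th12 p d Th) *\<^sub>v z)
      = - (f \<bullet> g) + w \<bullet> (Th12 p d Th *\<^sub>v z)"
    using LPsi L Psi w z c fg wL[OF fg(2)]
    by (subst add_mult_distrib_mat_vec[of _ p d]) (auto simp: scalar_prod_add_distrib[of _ p])
  have "z \<bullet> ((Psi0 * transpose_mat Psi0) *\<^sub>v z) = g \<bullet> g"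
    using scalar_prod_mult_transpose[OF Psi(1) z, of g] Psi z fg
    by (simp add: assoc_mult_mat_vec[of Psi0 d M] g_def)
  then have 3: "z \<bullet> ((Psi0 * transpose_mat Psi0 - Th22 p d Th) *\<^sub>v z) = g \<bullet> g - z \<bullet> (Th22 p d Th *\<^sub>v z)"
    using Psi z c by (subst minus_mult_distrib_mat_vec[of _ d d]) (auto simp: scalar_prod_minus_distrib[of _ d])
  let ?q = "w @\<^sub>v z"
  have q: "?q \<in> carrier_vec (p + d)" using w z by simp
  have "?q \<bullet> ((D * transpose_mat D) *\<^sub>v ?q) = (f + g) \<bullet> (f + g)"
    using scalar_prod_mult_transpose[OF D q, of "transpose_mat D *\<^sub>v ?q"] D q residual
    by (simp add: assoc_mult_mat_vec[of D "p + d" M] f_def g_def)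
  also have "\<dots> = f \<bullet> f + 2 * (f \<bullet> g) + g \<bullet> g"
    using fg comm_scalar_prod[of g M f] by (simp add: add_scalar_prod_distrib[of _ M] scalar_prod_add_distrib[of _ M])
  finally have DD: "?q \<bullet> ((D * transpose_mat D) *\<^sub>v ?q) = f \<bullet> f + 2 * (f \<bullet> g) + g \<bullet> g" .
  have "0 \<le> ?q \<bullet> ((Th - D * transpose_mat D) *\<^sub>v ?q)" using noise q by (simp add: psd_mat_def)
  also have "\<dots> = ?q \<bullet> (Th *\<^sub>v ?q) - ?q \<bullet> ((D * transpose_mat D) *\<^sub>v ?q)"
    using Th D q by (subst minus_mult_distrib_mat_vec[of _ "p + d" "p + d"]) (auto simp: scalar_prod_minus_distrib[of _ "p + d"])
  finally show ?thesis
    unfolding 1 2 3 DD quadratic_form_Theta_split[OF Th w z] by (simp add: algebra_simps)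
qed

text \<open>The change of variables \<open>Y = K P\<close> is undone on vectors, through
  \<open>P a = Mv\<close> and \<open>P b = v\<close>. Outside the data blocks the form then reads
  \<open>- a \<bullet> Mv + 2 a \<bullet> (F v + Bl K v) - b \<bullet> v + 2 a \<bullet> L Z
  v\<close>, which is \<open>a \<bullet> Mv - b \<bullet> v\<close>.\<close>

lemma lyapunov_decrease_from_lmi:
  fixes P L CC F Bl Y BB AA Z S :: "real mat"
  assumes P: "P \<in> carrier_mat d d" "transpose_mat P = P"
    and L: "L \<in> carrier_mat d p" and CC: "CC \<in> carrier_mat p p"
    and BB: "BB \<in> carrier_mat p d" and AA: "AA \<in> carrier_mat d d"
    and F: "F \<in> carrier_mat d d" and Bl: "Bl \<in> carrier_mat d m" and Y: "Y \<in> carrier_mat m d"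
    and nd: "nd_mat (3 * d) (block3 (- P - L * CC * transpose_mat L) (F * P + Bl * Y) (L * BB)
       (P * transpose_mat F + transpose_mat Y * transpose_mat Bl) (- P) (- P)
       (transpose_mat BB * transpose_mat L) (- P) (- AA))"
    and Z: "Z \<in> carrier_mat p d" and S: "S \<in> carrier_mat d d" "P * S = 1\<^sub>m d"
    and data: "\<And>w z. w \<in> carrier_vec p \<Longrightarrow> z = - (transpose_mat Z *\<^sub>v w) \<Longrightarrow>
      w \<bullet> (CC *\<^sub>v w) - 2 * (w \<bullet> (BB *\<^sub>v z)) + z \<bullet> (AA *\<^sub>v z) \<le> 0"
    and v: "v \<in> carrier_vec d" "v \<noteq> 0\<^sub>v d"
    and Mv: "Mv = F *\<^sub>v v + (Bl * (Y * S)) *\<^sub>v v + L *\<^sub>v (Z *\<^sub>v v)"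
  shows "(S *\<^sub>v Mv) \<bullet> Mv < (S *\<^sub>v v) \<bullet> v"
proof -
  define a where "a = S *\<^sub>v Mv"
  define b where "b = S *\<^sub>v v"
  define w where "w = transpose_mat L *\<^sub>v a"
  \<comment> \<open>With this third component the data blocks of the LMI contribute a nonnegative term, by \<open>data\<close>,
    and \<open>- 2 b \<bullet> P z\<close> supplies the missing part \<open>L Z\<close> of the closed-loop matrix.\<close>
  define z where "z = - (transpose_mat Z *\<^sub>v w)"
  let ?X = "F * P + Bl * Y"
  have Mvc: "Mv \<in> carrier_vec d" unfolding Mv
    using mult_mat_vec_carrier[OF mult_carrier_mat[OF Bl mult_carrier_mat[OF Y S(1)]] v(1)]
      mult_mat_vec_carrier[OF F v(1)] mult_mat_vec_carrier[OF L mult_mat_vec_carrier[OF Z v(1)]] by simp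
  have c: "a \<in> carrier_vec d" "b \<in> carrier_vec d" "w \<in> carrier_vec p" "z \<in> carrier_vec d"
    using S Mvc v L Z by (auto simp: a_def b_def w_def z_def)
  have PS: "P *\<^sub>v (S *\<^sub>v y) = y" if "y \<in> carrier_vec d" for y
    using assoc_mult_mat_vec[OF P(1) S(1) that] S that by simp
  have Pa: "P *\<^sub>v a = Mv" and Pb: "P *\<^sub>v b = v" using PS Mvc v by (auto simp: a_def b_def)
  have "b \<noteq> 0\<^sub>v d" using Pb P v by auto
  have Xc: "?X \<in> carrier_mat d d" using F P Bl Y by simp
  have Xt: "transpose_mat ?X = P * transpose_mat F + transpose_mat Y * transpose_mat Bl"
    using F P Bl Y by (simp add: transpose_add[of _ d d] transpose_mult[of _ d d] transpose_mult[of _ d m])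
  have "?X *\<^sub>v b = F *\<^sub>v (P *\<^sub>v b) + Bl *\<^sub>v (Y *\<^sub>v b)"
    using F P Bl Y c by (simp add: add_mult_distrib_mat_vec[of _ d d] assoc_mult_mat_vec[of _ d d] assoc_mult_mat_vec[of _ d m])
  also have "Y *\<^sub>v b = (Y * S) *\<^sub>v v" using assoc_mult_mat_vec[OF Y S(1) v(1)] by (simp add: b_def)
  also have "Bl *\<^sub>v ((Y * S) *\<^sub>v v) = (Bl * (Y * S)) *\<^sub>v v"
    using assoc_mult_mat_vec[OF Bl mult_carrier_mat[OF Y S(1)] v(1)] by simp
  finally have Xb: "?X *\<^sub>v b = F *\<^sub>v v + (Bl * (Y * S)) *\<^sub>v v" unfolding Pb .
  have "b \<bullet> (P *\<^sub>v z) = v \<bullet> z"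
    using scalar_prod_mult_transpose[OF P(1) c(2,4)] P(2) Pb by simp
  also have "\<dots> = - (v \<bullet> (transpose_mat Z *\<^sub>v w))" using v c Z by (simp add: z_def)
  also have "v \<bullet> (transpose_mat Z *\<^sub>v w) = (Z *\<^sub>v v) \<bullet> w"
    using scalar_prod_mult_transpose[of "transpose_mat Z" d p v w] Z v c by simp
  also have "\<dots> = (L *\<^sub>v (Z *\<^sub>v v)) \<bullet> a"
    using scalar_prod_mult_transpose[of "transpose_mat L" p d "Z *\<^sub>v v" a] L Z v c by (simp add: w_def)
  also have "\<dots> = a \<bullet> (L *\<^sub>v (Z *\<^sub>v v))" using L Z v c by (intro comm_scalar_prod[of _ d]) auto
  finally have bPz: "b \<bullet> (P *\<^sub>v z) = - (a \<bullet> (L *\<^sub>v (Z *\<^sub>v v)))" .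
  have aMv: "a \<bullet> Mv = a \<bullet> (F *\<^sub>v v + (Bl * (Y * S)) *\<^sub>v v) + a \<bullet> (L *\<^sub>v (Z *\<^sub>v v))"
    unfolding Mv
    using mult_mat_vec_carrier[OF mult_carrier_mat[OF Bl mult_carrier_mat[OF Y S(1)]] v(1)]
      mult_mat_vec_carrier[OF F v(1)] mult_mat_vec_carrier[OF L mult_mat_vec_carrier[OF Z v(1)]] c
    by (simp add: scalar_prod_add_distrib[of _ d])
  have "- (a \<bullet> (P *\<^sub>v a)) - w \<bullet> (CC *\<^sub>v w) + 2 * (a \<bullet> (?X *\<^sub>v b)) + 2 * (w \<bullet> (BB *\<^sub>v z))
      - b \<bullet> (P *\<^sub>v b) - 2 * (b \<bullet> (P *\<^sub>v z)) - z \<bullet> (AA *\<^sub>v z) < 0"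
    using lmi_quadratic_form[OF P L CC Xc BB AA _ c(1,2,4)] nd Xt \<open>b \<noteq> 0\<^sub>v d\<close> w_def by simp
  then have "a \<bullet> Mv < b \<bullet> v"
    using data[OF c(3) z_def] aMv bPz unfolding Pa Pb Xb by linarith
  then show ?thesis by (simp add: a_def b_def)
qed

section \<open>The closed loop\<close>

lemma right_inverse_of_symmetric_is_symmetric:
  fixes P S :: "real mat"
  assumes P: "P \<in> carrier_mat d d" "transpose_mat P = P" and S: "S \<in> carrier_mat d d" "P * S = 1\<^sub>m d"
  shows "transpose_mat S = S"
proof -
  have "transpose_mat S * P = 1\<^sub>m d"
    using transpose_mult[OF P(1) S(1)] P S by simp
  then have "S = (transpose_mat S * P) * S" using S by simp
  also have "\<dots> = transpose_mat S * (P * S)" using P S by (intro assoc_mult_mat) auto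
  finally show ?thesis using S by simp
qed

text \<open>A sample enters the last block and moves one block towards the front per step, so
  \<open>t\<close> steps later it sits in block \<open>l - 1 - t\<close>. Scalar coordinate
  functions let the same argument serve the output half and the input half of
  \<open>chi\<close>.\<close>

lemma shift_register_content:
  fixes f y :: "nat \<Rightarrow> nat \<Rightarrow> real"
  assumes step: "\<And>k i. i < q * l \<Longrightarrow> f (Suc k) i = (if i + q < q * l then f k (i + q) else y k (i + q - q * l))"
  shows "t < l \<Longrightarrow> r < q \<Longrightarrow> f (Suc (k + t)) (q * (l - 1 - t) + r) = y k r"
proof (induction t)
  case 0
  then obtain l' where "l = Suc l'" by (cases l) auto
  then show ?case using step[of "q * l' + r" k] 0 by simp
next
  case (Suc t)
  \<comment> \<open>Writing \<open>l\<close> as a sum turns the truncated differences into plain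
    block numbers.\<close>
  have "l = Suc (Suc t) + (l - Suc (Suc t))" using Suc.prems by simp
  then obtain l' where l: "l = Suc (Suc t) + l'" by blast
  have "f (Suc (k + Suc t)) (q * l' + r) = f (Suc (k + t)) (q * Suc l' + r)"
    using step[of "q * l' + r" "Suc (k + t)"] block_index_less[of l' l r q] block_index_less[of "Suc l'" l r q]
      Suc.prems l by (simp add: ac_simps)
  then show ?case using Suc l by simp
qed

lemma F_L_B_carrier [simp]:
  "F_mat p m l \<in> carrier_mat (p*l + m*l) (p*l + m*l)"
  "L_mat p m l \<in> carrier_mat (p*l + m*l) p"
  "B_mat p m l \<in> carrier_mat (p*l + m*l) m"
  by (auto simp: F_mat_def L_mat_def B_mat_def shift_mat_def)

lemma F_L_B_dim [simp]:
  "dim_row (F_mat p m l) = p*l + m*l" "dim_row (L_mat p m l) = p*l + m*l"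
  "dim_row (B_mat p m l) = p*l + m*l" "dim_col (F_mat p m l) = p*l + m*l"
  "dim_col (L_mat p m l) = p" "dim_col (B_mat p m l) = m"
  using F_L_B_carrier by blast+

text \<open>Each row of \<open>F_mat\<close>, \<open>B_mat\<close> and \<open>L_mat\<close> is zero
  or a unit vector, and at every index exactly one of the three rows is nonzero: either a shift
  within one half, or the newest sample entering its last block.\<close>

lemma shift_register_step_index:
  assumes w: "w \<in> carrier_vec (p*l + m*l)" and y: "y \<in> carrier_vec p" and u: "u \<in> carrier_vec m"
  shows "i < p*l \<Longrightarrow> (F_mat p m l *\<^sub>v w + B_mat p m l *\<^sub>v u + L_mat p m l *\<^sub>v y) $ i =
      (if i + p < p*l then w $ (i + p) else y $ (i + p - p*l))" (is "_ \<Longrightarrow> ?s $ i = _")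
    and "i < m*l \<Longrightarrow> (F_mat p m l *\<^sub>v w + B_mat p m l *\<^sub>v u + L_mat p m l *\<^sub>v y) $ (p*l + i) =
      (if i + m < m*l then w $ (p*l + (i + m)) else u $ (i + m - m*l))"
proof -
  let ?N = "p*l + m*l"
  { assume i: "i < p*l"
    \<comment> \<open>An index below \<open>p*l\<close> forces \<open>l > 0\<close>, so the
      truncated subtractions in \<open>L_mat\<close> and \<open>B_mat\<close> are exact.\<close>
    then obtain k where l: "l = Suc k" by (cases l) auto
    have "row (F_mat p m l) i = (if i + p < p*l then unit_vec ?N (i + p) else 0\<^sub>v ?N)"
      using i by (intro eq_vecI) (auto simp: F_mat_def shift_mat_def)
    moreover have "row (B_mat p m l) i = 0\<^sub>v m"
      using i by (intro eq_vecI) (auto simp: B_mat_def l)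
    moreover have "row (L_mat p m l) i = (if i + p < p*l then 0\<^sub>v p else unit_vec p (i + p - p*l))"
      using i by (intro eq_vecI) (auto simp: L_mat_def l)
    moreover have "?s $ i = row (F_mat p m l) i \<bullet> w + row (B_mat p m l) i \<bullet> u + row (L_mat p m l) i \<bullet> y"
      using i by simp
    ultimately show "?s $ i = (if i + p < p*l then w $ (i + p) else y $ (i + p - p*l))"
      using i w y u by auto }
  { assume i: "i < m*l"
    then obtain k where l: "l = Suc k" by (cases l) auto
    have "row (F_mat p m l) (p*l + i) = (if i + m < m*l then unit_vec ?N (p*l + (i + m)) else 0\<^sub>v ?N)"
      using i by (intro eq_vecI) (auto simp: F_mat_def shift_mat_def)
    moreover have "row (B_mat p m l) (p*l + i) = (if i + m < m*l then 0\<^sub>v m else unit_vec m (i + m - m*l))"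
      using i by (intro eq_vecI) (auto simp: B_mat_def l)
    moreover have "row (L_mat p m l) (p*l + i) = 0\<^sub>v p"
      using i by (intro eq_vecI) (auto simp: L_mat_def l)
    moreover have "?s $ (p*l + i) = row (F_mat p m l) (p*l + i) \<bullet> w + row (B_mat p m l) (p*l + i) \<bullet> u
        + row (L_mat p m l) (p*l + i) \<bullet> y"
      using i by simp
    ultimately show "?s $ (p*l + i) = (if i + m < m*l then w $ (p*l + (i + m)) else u $ (i + m - m*l))"
      using i w y u by auto }
qed

lemma shift_register_window:
  assumes chi0: "chi 0 \<in> carrier_vec (p*l + m*l)"
    and y: "\<And>k. y k \<in> carrier_vec p" and u: "\<And>k. u k \<in> carrier_vec m"
    and step: "\<And>k. chi (Suc k) = F_mat p m l *\<^sub>v chi k + B_mat p m l *\<^sub>v u k + L_mat p m l *\<^sub>v y k"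
    and k: "k \<ge> l"
  shows "chi k = stackv p y (k - l) l @\<^sub>v stackv m u (k - l) l"
proof (intro eq_vecI)
  have chi: "chi k \<in> carrier_vec (p*l + m*l)" for k
    by (cases k) (use chi0 in \<open>auto simp: step intro!: carrier_vecI\<close>)
  show "dim_vec (chi k) = dim_vec (stackv p y (k - l) l @\<^sub>v stackv m u (k - l) l)"
    using chi[of k] by simp
  note st = shift_register_step_index[OF chi y u]
  \<comment> \<open>Block \<open>s\<close> of the window entered at time \<open>k - l + s\<close>;
    after \<open>t = l - 1 - s\<close> further shifts it is block \<open>s\<close> at time
    \<open>k\<close>. These identities collapse the indices accordingly.\<close>
  have aux: "Suc (k - l + s + (l - 1 - s)) = k" "l - 1 - (l - 1 - s) = s" if "s < l" for s
    using that k by auto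
  fix i assume "i < dim_vec (stackv p y (k - l) l @\<^sub>v stackv m u (k - l) l)"
  then have i: "i < p*l + m*l" by simp
  show "chi k $ i = (stackv p y (k - l) l @\<^sub>v stackv m u (k - l) l) $ i"
  proof (cases "i < p*l")
    case True
    note dm = div_mod_less[OF True]
    have "chi (Suc (k - l + i div p + (l - 1 - i div p))) $ (p * (l - 1 - (l - 1 - i div p)) + i mod p)
        = y (k - l + i div p) $ (i mod p)"
      using st(1) dm
      by (intro shift_register_content[of p l "\<lambda>k i. chi k $ i" "\<lambda>k i. y k $ i"]) (auto simp: step)
    then have "chi k $ (p * (i div p) + i mod p) = y (k - l + i div p) $ (i mod p)"
      by (simp only: aux[OF dm(1)])
    then show ?thesis using True by (simp add: stackv_def)
  next
    case False
    define j where "j = i - p*l"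
    have j: "j < m*l" "i = p*l + j" using i False by (auto simp: j_def)
    note dm = div_mod_less[OF j(1)]
    have "chi (Suc (k - l + j div m + (l - 1 - j div m))) $ (p*l + (m * (l - 1 - (l - 1 - j div m)) + j mod m))
        = u (k - l + j div m) $ (j mod m)"
      using st(2) dm
      by (intro shift_register_content[of m l "\<lambda>k i. chi k $ (p*l + i)" "\<lambda>k i. u k $ i"]) (auto simp: step)
    then have "chi k $ (p*l + (m * (j div m) + j mod m)) = u (k - l + j div m) $ (j mod m)"
      by (simp only: aux[OF dm(1)])
    then show ?thesis using j by (simp add: stackv_def)
  qed
qed

section \<open>Cancellation of the noise-free signal in the recorded data\<close>

lemma stackv_add:
  assumes "\<And>i. i < l \<Longrightarrow> f (s + i) \<in> carrier_vec q" "\<And>i. i < l \<Longrightarrow> g (s + i) \<in> carrier_vec q"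
  shows "stackv q (\<lambda>k. f k + g k) s l = stackv q f s l + stackv q g s l"
proof (intro eq_vecI)
  fix i assume "i < dim_vec (stackv q f s l + stackv q g s l)"
  then have i: "i < q * l" by simp
  note dm = div_mod_less[OF i]
  show "stackv q (\<lambda>k. f k + g k) s l $ i = (stackv q f s l + stackv q g s l) $ i"
    using i dm assms(1,2)[OF dm(1)] by (simp add: stackv_def)
qed simp

lemma cols_mat_transpose_mult_vec:
  assumes "\<And>j. j < c \<Longrightarrow> g j \<in> carrier_vec d" "v \<in> carrier_vec d"
  shows "transpose_mat (cols_mat d c g) *\<^sub>v v = vec c (\<lambda>j. g j \<bullet> v)"
proof (intro eq_vecI)
  fix j assume "j < dim_vec (vec c (\<lambda>j. g j \<bullet> v))"
  then have j: "j < c" by simp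
  then have "row (transpose_mat (cols_mat d c g)) j = g j"
    using assms(1)[OF j] by (intro eq_vecI) (auto simp: cols_mat_def)
  then show "(transpose_mat (cols_mat d c g) *\<^sub>v v) $ j = vec c (\<lambda>j. g j \<bullet> v) $ j"
    using j by (simp add: cols_mat_def)
qed (simp add: cols_mat_def)

text \<open>Column \<open>j\<close> of \<open>Psi0\<close> is a true window plus noise,
  \<open>W j + D j\<close>, and \<open>L_mat\<close> picks \<open>ym (j + l)\<close> from column
  \<open>j\<close> of \<open>Psi1\<close>. With \<open>z = - Z^T w\<close>, the true output
  \<open>Z W j\<close> tested against \<open>w\<close> cancels \<open>W j\<close> tested against
  \<open>z\<close>.\<close>

lemma data_residual:
  fixes x u du dy :: "nat \<Rightarrow> real vec" and C Z :: "real mat"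
  assumes l: "0 < l" and T: "l \<le> T" and C: "C \<in> carrier_mat p n" and Z: "Z \<in> carrier_mat p (p*l + m*l)"
    and x: "\<And>k. k \<le> T \<Longrightarrow> x k \<in> carrier_vec n" and u: "\<And>k. k \<le> T \<Longrightarrow> u k \<in> carrier_vec m"
    and du: "\<And>k. k \<le> T \<Longrightarrow> du k \<in> carrier_vec m" and dy: "\<And>k. k \<le> T \<Longrightarrow> dy k \<in> carrier_vec p"
    and Zx: "\<And>j. j + l \<le> T \<Longrightarrow> C *\<^sub>v x (j + l) =
       Z *\<^sub>v (stackv p (\<lambda>k. C *\<^sub>v x k) j l @\<^sub>v stackv m u j l)"
    and w: "w \<in> carrier_vec p" and z: "z = - (transpose_mat Z *\<^sub>v w)"
  defines "ym \<equiv> \<lambda>k. C *\<^sub>v x k + dy k" and "um \<equiv> \<lambda>k. u k + du k"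
  shows "transpose_mat (Psi_mat p m l T ym um 1) *\<^sub>v (L_mat p m l *\<^sub>v w)
      + transpose_mat (Psi_mat p m l T ym um 0) *\<^sub>v z = transpose_mat (Delta10_mat p m l T dy du) *\<^sub>v (w @\<^sub>v z)"
proof -
  let ?N = "p*l + m*l" and ?M = "T - l + 1"
  have zc: "z \<in> carrier_vec ?N" using Z w by (simp add: z)
  define D where "D j = stackv p dy j l @\<^sub>v stackv m du j l" for j
  define W where "W j = stackv p (\<lambda>k. C *\<^sub>v x k) j l @\<^sub>v stackv m u j l" for j
  define Psi where "Psi j = stackv p ym j l @\<^sub>v stackv m um j l" for j
  have c: "D j \<in> carrier_vec ?N" "W j \<in> carrier_vec ?N" "Psi j \<in> carrier_vec ?N" for j
    by (auto simp: D_def W_def Psi_def)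
  have 1: "transpose_mat (Psi_mat p m l T ym um 1) *\<^sub>v (L_mat p m l *\<^sub>v w) = vec ?M (\<lambda>j. Psi (j + 1) \<bullet> (L_mat p m l *\<^sub>v w))"
    unfolding Psi_mat_def Psi_def using w by (intro cols_mat_transpose_mult_vec) (auto intro: mult_mat_vec_carrier[OF F_L_B_carrier(2)])
  have 2: "transpose_mat (Psi_mat p m l T ym um 0) *\<^sub>v z = vec ?M (\<lambda>j. Psi j \<bullet> z)"
    unfolding Psi_mat_def Psi_def using zc by (subst cols_mat_transpose_mult_vec) auto
  have 3: "transpose_mat (Delta10_mat p m l T dy du) *\<^sub>v (w @\<^sub>v z) = vec ?M (\<lambda>j. (dy (j + l) @\<^sub>v D j) \<bullet> (w @\<^sub>v z))"
    unfolding Delta10_mat_def D_def using w zc dy T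
    by (intro cols_mat_transpose_mult_vec) (auto simp: add.assoc)
  have "Psi (j + 1) \<bullet> (L_mat p m l *\<^sub>v w) + Psi j \<bullet> z = (dy (j + l) @\<^sub>v D j) \<bullet> (w @\<^sub>v z)" if j: "j < ?M" for j
  proof -
    have jl: "j + l \<le> T" using j T by simp
    note cc = C x[OF jl] dy[OF jl]
    \<comment> \<open>The last output block of \<open>Psi (j + 1)\<close> has number
      \<open>l - 1\<close>, hence is the sample at time
      \<open>j + 1 + (l - 1) = j + l\<close>.\<close>
    have "p * l = p * (l - 1) + p" using l by (cases l) auto
    then have pl: "p * l - p = p * (l - 1)" by simp
    have "transpose_mat (L_mat p m l) = select_mat p ?N (\<lambda>r. p*l - p + r)"
      by (intro eq_matI) (auto simp: L_mat_def select_mat_def)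
    moreover have "p*l - p + r < ?N" if "r < p" for r
      unfolding pl using block_index_less[of "l - 1" l r p] l that by simp
    ultimately have "transpose_mat (L_mat p m l) *\<^sub>v Psi (j + 1) = vec p (\<lambda>r. Psi (j + 1) $ (p*l - p + r))"
      using select_mat_mult_vec[OF c(3)] by metis
    also have "\<dots> = ym (j + l)"
    proof (intro eq_vecI)
      fix r assume "r < dim_vec (ym (j + l))"
      then have r: "r < p" using cc by (simp add: ym_def)
      then show "vec p (\<lambda>r. Psi (j + 1) $ (p*l - p + r)) $ r = ym (j + l) $ r"
        unfolding pl Psi_def using l block_index_less[of "l - 1" l r p] by (simp add: stackv_index)
    qed (use cc in \<open>simp add: ym_def\<close>)
    finally have "Psi (j + 1) \<bullet> (L_mat p m l *\<^sub>v w) = ym (j + l) \<bullet> w"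
      using scalar_prod_mult_transpose[of "L_mat p m l" ?N p "Psi (j + 1)" w] c w by simp
    also have "\<dots> = (C *\<^sub>v x (j + l)) \<bullet> w + dy (j + l) \<bullet> w"
      unfolding ym_def using cc w by (intro add_scalar_prod_distrib[of _ p]) auto
    also have "C *\<^sub>v x (j + l) = Z *\<^sub>v W j" unfolding W_def by (rule Zx[OF jl])
    also have "(Z *\<^sub>v W j) \<bullet> w = W j \<bullet> (transpose_mat Z *\<^sub>v w)"
      using scalar_prod_mult_transpose[of "transpose_mat Z" ?N p "W j" w] Z c w by simp
    also have "\<dots> = - (W j \<bullet> z)" using c Z w by (simp add: z)
    finally have A: "Psi (j + 1) \<bullet> (L_mat p m l *\<^sub>v w) = - (W j \<bullet> z) + dy (j + l) \<bullet> w" .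
    have "Psi j = W j + D j"
    proof -
      have "stackv p ym j l = stackv p (\<lambda>k. C *\<^sub>v x k) j l + stackv p dy j l"
        unfolding ym_def using C x dy jl by (intro stackv_add) (auto intro: mult_mat_vec_carrier)
      moreover have "stackv m um j l = stackv m u j l + stackv m du j l"
        unfolding um_def using u du jl by (intro stackv_add) auto
      ultimately show ?thesis
        unfolding Psi_def W_def D_def by (simp add: append_vec_add[of _ "p*l" _ _ "m*l"])
    qed
    then have "Psi j \<bullet> z = W j \<bullet> z + D j \<bullet> z" using c zc by (simp add: add_scalar_prod_distrib[of _ ?N])
    then show ?thesis using A cc c w zc by (simp add: scalar_prod_append[of _ p _ ?N])
  qed
  then show ?thesis unfolding 1 2 3 by (intro eq_vecI) auto
qed

section \<open>Stability\<close>

lemma sq_add_le: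
  assumes "a \<in> carrier_vec d" "b \<in> carrier_vec d"
  shows "(a + b) \<bullet> (a + b) \<le> 2 * (a \<bullet> a) + 2 * (b \<bullet> (b :: real vec))"
proof -
  have "(a - b) \<bullet> (a - b) \<ge> 0" by (rule scalar_prod_self_nonneg)
  then show ?thesis using assms comm_scalar_prod[of b d a]
    by (simp add: add_scalar_prod_distrib[of _ d] scalar_prod_add_distrib[of _ d]
        minus_scalar_prod_distrib[of _ d] scalar_prod_minus_distrib[of _ d])
qed

lemma linear_sum_sq_bound:
  fixes M1 M2 :: "real mat"
  assumes M: "M1 \<in> carrier_mat r c1" "M2 \<in> carrier_mat r c2"
  shows "\<exists>k\<ge>0. \<forall>v\<in>carrier_vec c1. \<forall>w\<in>carrier_vec c2.
    (M1 *\<^sub>v v + M2 *\<^sub>v w) \<bullet> (M1 *\<^sub>v v + M2 *\<^sub>v w) \<le> k * (v \<bullet> v + w \<bullet> w)"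
proof -
  obtain k1 k2 where k: "k1 \<ge> 0" "k2 \<ge> 0"
    and b1: "\<forall>v\<in>carrier_vec c1. (M1 *\<^sub>v v) \<bullet> (M1 *\<^sub>v v) \<le> k1 * (v \<bullet> v)"
    and b2: "\<forall>v\<in>carrier_vec c2. (M2 *\<^sub>v v) \<bullet> (M2 *\<^sub>v v) \<le> k2 * (v \<bullet> v)"
    using mult_mat_vec_sq_bound[OF M(1)] mult_mat_vec_sq_bound[OF M(2)] by blast
  have "(M1 *\<^sub>v v + M2 *\<^sub>v w) \<bullet> (M1 *\<^sub>v v + M2 *\<^sub>v w) \<le> (2 * k1 + 2 * k2) * (v \<bullet> v + w \<bullet> w)"
    if "v \<in> carrier_vec c1" "w \<in> carrier_vec c2" for v w
  proof -
    have "(M1 *\<^sub>v v + M2 *\<^sub>v w) \<bullet> (M1 *\<^sub>v v + M2 *\<^sub>v w)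
        \<le> 2 * ((M1 *\<^sub>v v) \<bullet> (M1 *\<^sub>v v)) + 2 * ((M2 *\<^sub>v w) \<bullet> (M2 *\<^sub>v w))"
      using M that by (intro sq_add_le[of _ r]) auto
    also have "\<dots> \<le> 2 * (k1 * (v \<bullet> v)) + 2 * (k2 * (w \<bullet> w))"
      using b1 b2 that by (intro add_mono mult_left_mono) auto
    also have "\<dots> \<le> (2 * k1 + 2 * k2) * (v \<bullet> v + w \<bullet> w)"
      using k scalar_prod_self_nonneg[of v] scalar_prod_self_nonneg[of w]
      by (simp add: algebra_simps)
    finally show ?thesis .
  qed
  then show ?thesis using k by (intro exI[of _ "2 * k1 + 2 * k2"]) auto
qed

text \<open>Strict decrease at each single vector says that \<open>Q = S - M^T S M\<close> is
  positive definite, and coercivity of \<open>Q\<close> makes this quantitative: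
  \<open>v k \<bullet> v k\<close> is at most \<open>q\<close> times the drop of \<open>V\<close> in
  that step. A drop never exceeds \<open>V 0\<close>, which gives the bound; the drops of a
  convergent sequence tend to zero, which gives the limit.\<close>

lemma lyapunov_sequence:
  fixes S M :: "real mat" and v :: "nat \<Rightarrow> real vec"
  assumes S: "S \<in> carrier_mat d d" "transpose_mat S = S"
    and nonneg: "\<And>v. v \<in> carrier_vec d \<Longrightarrow> 0 \<le> v \<bullet> (S *\<^sub>v v)"
    and M: "M \<in> carrier_mat d d"
    and dec: "\<And>v. v \<in> carrier_vec d \<Longrightarrow> v \<noteq> 0\<^sub>v d \<Longrightarrow> (M *\<^sub>v v) \<bullet> (S *\<^sub>v (M *\<^sub>v v)) < v \<bullet> (S *\<^sub>v v)"
  shows "\<exists>c\<ge>0. \<forall>v. v 0 \<in> carrier_vec d \<longrightarrow> (\<forall>k. v (Suc k) = M *\<^sub>v v k) \<longrightarrow>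
    (\<forall>k. v k \<bullet> v k \<le> c * (v 0 \<bullet> v 0)) \<and> (\<lambda>k. v k \<bullet> v k) \<longlonglongrightarrow> 0"
proof -
  define Q where "Q = S - transpose_mat M * S * M"
  have Qc: "Q \<in> carrier_mat d d" using S M by (auto simp: Q_def intro!: minus_carrier_mat)
  have Qv: "v \<bullet> (Q *\<^sub>v v) = v \<bullet> (S *\<^sub>v v) - (M *\<^sub>v v) \<bullet> (S *\<^sub>v (M *\<^sub>v v))"
    if v: "v \<in> carrier_vec d" for v
  proof -
    have "(transpose_mat M * S * M) *\<^sub>v v = transpose_mat M *\<^sub>v (S *\<^sub>v (M *\<^sub>v v))"
      using S M v by (simp add: assoc_mult_mat_vec[of _ d d _ d])
    then have "v \<bullet> ((transpose_mat M * S * M) *\<^sub>v v) = (M *\<^sub>v v) \<bullet> (S *\<^sub>v (M *\<^sub>v v))"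
      using scalar_prod_mult_transpose[of "transpose_mat M" d d v "S *\<^sub>v (M *\<^sub>v v)"] S M v by simp
    moreover have W: "transpose_mat M * S * M \<in> carrier_mat d d" using S M by simp
    ultimately show ?thesis
      by (simp only: Q_def minus_mult_distrib_mat_vec[OF S(1) W v]
          scalar_prod_minus_distrib[OF v mult_mat_vec_carrier[OF S(1) v] mult_mat_vec_carrier[OF W v]])
  qed
  have "transpose_mat Q = Q"
    unfolding Q_def using S M
    by (simp add: transpose_minus[of _ d d] transpose_mult[of _ d d _ d] assoc_mult_mat[of _ d d _ d _ d])
  then have "pd_mat d Q" using Qc Qv dec by (auto simp: pd_mat_def)
  from pd_mat_sq_bound[OF this] obtain q where q: "q \<ge> 0" and
    qb: "\<And>v. v \<in> carrier_vec d \<Longrightarrow> v \<bullet> v \<le> q * (v \<bullet> (Q *\<^sub>v v))" by blast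
  obtain s where s: "s \<ge> 0" and sb: "\<And>v. v \<in> carrier_vec d \<Longrightarrow> (S *\<^sub>v v) \<bullet> (S *\<^sub>v v) \<le> s * (v \<bullet> v)"
    using mult_mat_vec_sq_bound[OF S(1)] by blast
  show ?thesis
  proof (intro exI[of _ "q * (1 + s)"] conjI allI impI)
    show "0 \<le> q * (1 + s)" using q s by simp
    fix v :: "nat \<Rightarrow> real vec"
    assume v0: "v 0 \<in> carrier_vec d" and step: "\<forall>k. v (Suc k) = M *\<^sub>v v k"
    define V where "V k = v k \<bullet> (S *\<^sub>v v k)" for k
    have vc: "v k \<in> carrier_vec d" for k using v0 M by (induction k) (auto simp: step)
    have qV: "v k \<bullet> v k \<le> q * (V k - V (Suc k))" for k
      using qb[OF vc] Qv[OF vc] by (simp add: V_def step)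
    have Vnn: "0 \<le> V k" for k using nonneg[OF vc] by (simp add: V_def)
    have Vdec: "V (Suc k) \<le> V k" for k
    proof (cases "v k = 0\<^sub>v d")
      case True
      then have "v (Suc k) = 0\<^sub>v d" using M step by (intro eq_vecI) auto
      then show ?thesis using True by (simp add: V_def)
    next
      case False
      then show ?thesis using dec[OF vc] by (simp add: V_def step less_imp_le)
    qed
    then have "V k \<le> V 0" for k by (rule lift_Suc_antimono_le) simp
    moreover have "V 0 \<le> (1 + s) * (v 0 \<bullet> v 0)"
    proof -
      \<comment> \<open>Expanding the square gives \<open>2 V 0 \<le> |v 0|^2 + |S v 0|^2\<close>;
        with the bound \<open>s\<close> for \<open>S\<close> this is the origin of the factor
        \<open>1 + s\<close>.\<close>
      have "0 \<le> (v 0 - S *\<^sub>v v 0) \<bullet> (v 0 - S *\<^sub>v v 0)" by (rule scalar_prod_self_nonneg)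
      then have "2 * V 0 \<le> v 0 \<bullet> v 0 + (S *\<^sub>v v 0) \<bullet> (S *\<^sub>v v 0)"
        using v0 S comm_scalar_prod[of "S *\<^sub>v v 0" d "v 0"]
        by (simp add: V_def minus_scalar_prod_distrib[of _ d] scalar_prod_minus_distrib[of _ d])
      then show ?thesis using sb[OF v0] Vnn[of 0] scalar_prod_self_nonneg[of "v 0"] by (simp add: algebra_simps)
    qed
    ultimately have Vb: "V k \<le> (1 + s) * (v 0 \<bullet> v 0)" for k using order_trans by blast
    show "v k \<bullet> v k \<le> q * (1 + s) * (v 0 \<bullet> v 0)" for k
    proof -
      have "v k \<bullet> v k \<le> q * (V k - V (Suc k))" by (rule qV)
      also have "\<dots> \<le> q * ((1 + s) * (v 0 \<bullet> v 0))"
        using Vb[of k] Vnn[of "Suc k"] q by (intro mult_left_mono) auto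
      finally show ?thesis by simp
    qed
    have "convergent V"
      by (rule Bseq_monoseq_convergent[OF Bseq_eq_bounded[of V 0 "V 0"]])
        (use Vnn \<open>\<And>k. V k \<le> V 0\<close> Vdec in \<open>auto simp: monoseq_Suc\<close>)
    then obtain V' where "V \<longlonglongrightarrow> V'" by (auto simp: convergent_def)
    then have "(\<lambda>k. q * (V k - V (Suc k))) \<longlonglongrightarrow> q * (V' - V')"
      by (intro tendsto_intros LIMSEQ_Suc)
    then have lim: "(\<lambda>k. q * (V k - V (Suc k))) \<longlonglongrightarrow> 0" by simp
    show "(\<lambda>k. v k \<bullet> v k) \<longlonglongrightarrow> 0"
      by (rule tendsto_sandwich[OF _ _ tendsto_const lim]) (auto simp: qV scalar_prod_self_nonneg)
  qed
qed

section \<open>From the tail dynamics to global asymptotic stability of the interconnection\<close>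

lemma cl_solution_carrier:
  assumes A: "A \<in> carrier_mat n n" and B: "B \<in> carrier_mat n m" and C: "C \<in> carrier_mat p n"
    and F: "F \<in> carrier_mat N N" and L: "L \<in> carrier_mat N p" and Bl: "Bl \<in> carrier_mat N m"
    and K: "K \<in> carrier_mat m N" and sol: "cl_solution n N A B C F L Bl K x chi"
  shows "x k \<in> carrier_vec n \<and> chi k \<in> carrier_vec N"
proof (induction k)
  case 0
  then show ?case using sol by (simp add: cl_solution_def)
next
  case (Suc k)
  have "F + Bl * K \<in> carrier_mat N N" using F Bl K by simp
  then show ?case
    using sol Suc mult_mat_vec_carrier[of "F + Bl * K" N N "chi k"] A B C L K
    by (auto simp: cl_solution_def)
qed

lemma cl_GAS_of_tail_reduction:
  fixes A B C F L Bl K M R S :: "real mat"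
  assumes A: "A \<in> carrier_mat n n" and B: "B \<in> carrier_mat n m" and C: "C \<in> carrier_mat p n"
    and F: "F \<in> carrier_mat N N" and L: "L \<in> carrier_mat N p" and Bl: "Bl \<in> carrier_mat N m"
    and K: "K \<in> carrier_mat m N"
    and S: "S \<in> carrier_mat N N" "transpose_mat S = S"
    and nonneg: "\<And>v. v \<in> carrier_vec N \<Longrightarrow> 0 \<le> v \<bullet> (S *\<^sub>v v)"
    and M: "M \<in> carrier_mat N N" and R: "R \<in> carrier_mat n N"
    and dec: "\<And>v. v \<in> carrier_vec N \<Longrightarrow> v \<noteq> 0\<^sub>v N \<Longrightarrow> (M *\<^sub>v v) \<bullet> (S *\<^sub>v (M *\<^sub>v v)) < v \<bullet> (S *\<^sub>v v)"
    and tail: "\<And>x chi k. cl_solution n N A B C F L Bl K x chi \<Longrightarrow> k \<ge> l \<Longrightarrow>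
      x k = R *\<^sub>v chi k \<and> chi (Suc k) = M *\<^sub>v chi k"
  shows "cl_GAS n N A B C F L Bl K"
proof -
  obtain k1 where k1: "k1 \<ge> 0" and kb1: "\<And>v w. v \<in> carrier_vec n \<Longrightarrow> w \<in> carrier_vec N \<Longrightarrow>
      (A *\<^sub>v v + (B * K) *\<^sub>v w) \<bullet> (A *\<^sub>v v + (B * K) *\<^sub>v w) \<le> k1 * (v \<bullet> v + w \<bullet> w)"
    using linear_sum_sq_bound[OF A mult_carrier_mat[OF B K]] by blast
  obtain k2 where k2: "k2 \<ge> 0" and kb2: "\<And>v w. v \<in> carrier_vec N \<Longrightarrow> w \<in> carrier_vec n \<Longrightarrow>
      ((F + Bl * K) *\<^sub>v v + (L * C) *\<^sub>v w) \<bullet> ((F + Bl * K) *\<^sub>v v + (L * C) *\<^sub>v w) \<le> k2 * (v \<bullet> v + w \<bullet> w)"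
    using linear_sum_sq_bound[OF add_carrier_mat[OF mult_carrier_mat[OF Bl K]] mult_carrier_mat[OF L C], of F]
    by blast
  obtain r where r: "r \<ge> 0" and rb: "\<And>v. v \<in> carrier_vec N \<Longrightarrow> (R *\<^sub>v v) \<bullet> (R *\<^sub>v v) \<le> r * (v \<bullet> v)"
    using mult_mat_vec_sq_bound[OF R] by blast
  obtain c where c: "c \<ge> 0" and cb: "\<And>v. v 0 \<in> carrier_vec N \<Longrightarrow> (\<And>k. v (Suc k) = M *\<^sub>v v k) \<Longrightarrow>
    (\<forall>k. v k \<bullet> v k \<le> c * (v 0 \<bullet> v 0)) \<and> (\<lambda>k. v k \<bullet> v k) \<longlonglongrightarrow> 0"
    using lyapunov_sequence[OF S nonneg M dec] by blast
  \<comment> \<open>\<open>g\<close> bounds the growth of \<open>|x|^2 + |chi|^2\<close> in one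
    step; its summand 1 makes the powers increasing, so that \<open>g ^ l\<close> covers all of the
    first \<open>l\<close> steps. In \<open>G\<close>, the tail contributes \<open>1 + r\<close>
    through \<open>x = R chi\<close> and \<open>c\<close> through the Lyapunov bound; the added 1
    keeps \<open>G\<close> above \<open>g ^ l\<close> alone.\<close>
  define g where "g = 1 + k1 + k2"
  define G where "G = ((1 + r) * c + 1) * g ^ l"
  have g: "g \<ge> 1" using k1 k2 by (simp add: g_def)
  have G: "G \<ge> 0" using r c g by (simp add: G_def)
  have bound: "x k \<bullet> x k + chi k \<bullet> chi k \<le> G * (x 0 \<bullet> x 0 + chi 0 \<bullet> chi 0)"
    and lim: "(\<lambda>k. x k \<bullet> x k + chi k \<bullet> chi k) \<longlonglongrightarrow> 0"
    and carr: "x k \<in> carrier_vec n" "chi k \<in> carrier_vec N"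
    if sol: "cl_solution n N A B C F L Bl K x chi" for x chi k
  proof -
    note s = sol[unfolded cl_solution_def]
    note xc = cl_solution_carrier[OF A B C F L Bl K sol]
    then show "x k \<in> carrier_vec n" "chi k \<in> carrier_vec N" by auto
    define E where "E k = x k \<bullet> x k + chi k \<bullet> chi k" for k
    have Enn: "E k \<ge> 0" for k by (simp add: E_def scalar_prod_self_nonneg)
    have Estep: "E (Suc k) \<le> g * E k" for k
    proof -
      have "x (Suc k) = A *\<^sub>v x k + (B * K) *\<^sub>v chi k"
        using s xc[of k] B K by (simp add: assoc_mult_mat_vec[of B n m K N])
      moreover have "chi (Suc k) = (F + Bl * K) *\<^sub>v chi k + (L * C) *\<^sub>v x k"
        using s xc[of k] L C by (simp add: assoc_mult_mat_vec[of L N p C n])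
      ultimately have "E (Suc k) \<le> k1 * E k + k2 * E k"
        using kb1[of "x k" "chi k"] kb2[of "chi k" "x k"] xc[of k] by (simp add: E_def algebra_simps)
      also have "\<dots> \<le> g * E k" using Enn[of k] by (simp add: g_def algebra_simps)
      finally show ?thesis .
    qed
    have Epow: "E k \<le> g ^ k * E 0" for k
    proof (induction k)
      case (Suc k)
      have "E (Suc k) \<le> g * (g ^ k * E 0)"
        using Estep[of k] mult_left_mono[OF Suc, of g] g by linarith
      then show ?case by (simp add: mult.assoc)
    qed simp
    have Epl: "E k \<le> g ^ l * E 0" if "k \<le> l" for k
      using Epow[of k] mult_right_mono[OF power_increasing[OF that g] Enn[of 0]] by linarith
    \<comment> \<open>Shifting time by \<open>l\<close> makes the controller state a trajectory of
      \<open>M\<close> started at \<open>chi l\<close>.\<close>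
    have st: "chi (l + Suc k) = M *\<^sub>v chi (l + k)" and xr: "x (l + k) = R *\<^sub>v chi (l + k)" for k
      using tail[OF sol, of "l + k"] by auto
    from cb[of "\<lambda>k. chi (l + k)"] xc st
    have chib: "chi (l + k) \<bullet> chi (l + k) \<le> c * (chi l \<bullet> chi l)"
      and chil: "(\<lambda>k. chi (l + k) \<bullet> chi (l + k)) \<longlonglongrightarrow> 0" for k
      by auto
    have Er: "E (l + k) \<le> (1 + r) * (chi (l + k) \<bullet> chi (l + k))" for k
      using rb[of "chi (l + k)"] xc xr[of k] by (simp add: E_def algebra_simps)
    have "(\<lambda>k. (1 + r) * (chi (l + k) \<bullet> chi (l + k))) \<longlonglongrightarrow> (1 + r) * 0"
      by (intro tendsto_mult_left chil)
    then have lim: "(\<lambda>k. (1 + r) * (chi (l + k) \<bullet> chi (l + k))) \<longlonglongrightarrow> 0" by simp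
    have "(\<lambda>k. E (l + k)) \<longlonglongrightarrow> 0"
      by (rule tendsto_sandwich[OF _ _ tendsto_const lim]) (auto simp: Er Enn)
    then have "(\<lambda>k. E (k + l)) \<longlonglongrightarrow> 0" by (simp add: add.commute)
    then have "E \<longlonglongrightarrow> 0" by (rule LIMSEQ_offset)
    then show "(\<lambda>k. x k \<bullet> x k + chi k \<bullet> chi k) \<longlonglongrightarrow> 0" by (simp add: E_def[abs_def])
    have "E k \<le> G * E 0" for k
    proof (cases "k \<le> l")
      case True
      have "1 * (g ^ l * E 0) \<le> ((1 + r) * c + 1) * (g ^ l * E 0)"
        using r c g Enn[of 0] by (intro mult_right_mono) auto
      then show ?thesis using Epl[OF True] by (simp add: G_def mult.assoc)
    next
      case False
      then obtain j where k: "k = l + j" by (metis le_add_diff_inverse nat_le_linear)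
      have "E k \<le> (1 + r) * (c * (chi l \<bullet> chi l))"
        unfolding k using Er[of j] mult_left_mono[OF chib[of j], of "1 + r"] r by linarith
      also have "\<dots> \<le> (1 + r) * (c * (g ^ l * E 0))"
        using r c Epl[of l] scalar_prod_self_nonneg[of "x l"] unfolding E_def
        by (intro mult_left_mono) auto
      also have "\<dots> \<le> ((1 + r) * c + 1) * (g ^ l * E 0)"
        using g Enn[of 0] by (simp add: algebra_simps)
      finally show ?thesis by (simp add: G_def mult.assoc)
    qed
    then show "x k \<bullet> x k + chi k \<bullet> chi k \<le> G * (x 0 \<bullet> x 0 + chi 0 \<bullet> chi 0)" by (simp add: E_def)
  qed
  have nrm: "vnorm (x k @\<^sub>v chi k) = sqrt (x k \<bullet> x k + chi k \<bullet> chi k)"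
    if "cl_solution n N A B C F L Bl K x chi" for x chi k
    using carr[OF that, of k] by (simp add: vnorm_def scalar_prod_append[of _ n _ N])
  show ?thesis unfolding cl_GAS_def
  proof (intro conjI allI impI)
    fix \<epsilon> :: real assume e: "\<epsilon> > 0"
    \<comment> \<open>\<open>G\<close> bounds squared norms, hence the root; \<open>G + 1\<close>
      makes the divisor positive from \<open>G \<ge> 0\<close>.\<close>
    define \<delta> where "\<delta> = \<epsilon> / sqrt (G + 1)"
    have "vnorm (x k @\<^sub>v chi k) < \<epsilon>"
      if sol: "cl_solution n N A B C F L Bl K x chi" and d: "vnorm (x 0 @\<^sub>v chi 0) < \<delta>" for x chi k
    proof -
      have "vnorm (x k @\<^sub>v chi k) \<le> sqrt ((G + 1) * (x 0 \<bullet> x 0 + chi 0 \<bullet> chi 0))"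
        unfolding nrm[OF sol]
        using bound[OF sol, of k] scalar_prod_self_nonneg[of "x 0"] scalar_prod_self_nonneg[of "chi 0"]
        by (intro real_sqrt_le_mono) (simp add: algebra_simps)
      also have "\<dots> = sqrt (G + 1) * vnorm (x 0 @\<^sub>v chi 0)" by (simp add: nrm[OF sol] real_sqrt_mult)
      also have "\<dots> < sqrt (G + 1) * \<delta>" using d G by (intro mult_strict_left_mono) auto
      also have "\<dots> = \<epsilon>" using G by (simp add: \<delta>_def)
      finally show ?thesis .
    qed
    moreover have "\<delta> > 0" using e G by (simp add: \<delta>_def)
    ultimately show "\<exists>\<delta>>0. \<forall>x chi. cl_solution n N A B C F L Bl K x chi \<and> vnorm (x 0 @\<^sub>v chi 0) < \<delta>
        \<longrightarrow> (\<forall>k. vnorm (x k @\<^sub>v chi k) < \<epsilon>)" by blast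
  next
    fix x chi assume sol: "cl_solution n N A B C F L Bl K x chi"
    show "(\<lambda>k. vnorm (x k @\<^sub>v chi k)) \<longlonglongrightarrow> 0"
      unfolding nrm[OF sol] using tendsto_real_sqrt[OF lim[OF sol]] by simp
  qed
qed

theorem theorem1:
  fixes n m p T :: nat
    and A B C Th P Y K :: "real mat"
    and x u du dy :: "nat \<Rightarrow> real vec"
  defines "l \<equiv> obs_index n A C"
  defines "N \<equiv> p*l + m*l"
  defines "ym \<equiv> (\<lambda>k. C *\<^sub>v x k + dy k)"
  defines "um \<equiv> (\<lambda>k. u k + du k)"
  defines "Psi1 \<equiv> Psi_mat p m l T ym um 1"
  defines "Psi0 \<equiv> Psi_mat p m l T ym um 0"
  defines "Delta10 \<equiv> Delta10_mat p m l T dy du"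
  defines "F \<equiv> F_mat p m l"
  defines "L \<equiv> L_mat p m l"
  defines "Bl \<equiv> B_mat p m l"
  defines "AA \<equiv> Psi0 * transpose_mat Psi0 - Th22 p N Th"
  defines "BB \<equiv> - (transpose_mat L * Psi1 * transpose_mat Psi0) + Th12 p N Th"
  defines "CC \<equiv> transpose_mat L * Psi1 * transpose_mat Psi1 * L - Th11 p Th"
  assumes A: "A \<in> carrier_mat n n" and B: "B \<in> carrier_mat n m" and C: "C \<in> carrier_mat p n"
    and obs: "observable n A C"
    and T: "T \<ge> l"
    and x0: "x 0 \<in> carrier_vec n"
    and sig: "\<forall>k\<le>T. u k \<in> carrier_vec m \<and> du k \<in> carrier_vec m \<and> dy k \<in> carrier_vec p"
    and dyn: "\<forall>k\<le>T. x (Suc k) = A *\<^sub>v x k + B *\<^sub>v u k"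
    and Th: "psd_mat (p + N) Th"
    and noise: "psd_mat (p + N) (Th - Delta10 * transpose_mat Delta10)"
    and excit: "pd_mat N (Psi0 * transpose_mat Psi0 - Th22 p N Th)"
    and Y: "Y \<in> carrier_mat m N"
    and P: "pd_mat N P"
    and LMI: "nd_mat (3 * N)
       (block3 (- P - L * CC * transpose_mat L) (F * P + Bl * Y) (L * BB)
               (P * transpose_mat F + transpose_mat Y * transpose_mat Bl) (- P) (- P)
               (transpose_mat BB * transpose_mat L) (- P) (- AA))"
    and K: "K = Y * the (mat_inverse P)"
  shows "cl_GAS n N A B C F L Bl K \<and>
    (\<forall>xs chi. cl_solution n N A B C F L Bl K xs chi \<longrightarrow>
       (\<forall>k\<ge>l. chi k = stackv p (\<lambda>i. C *\<^sub>v xs i) (k - l) l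
                     @\<^sub>v stackv m (\<lambda>i. K *\<^sub>v chi i) (k - l) l))"
proof -
  have rk: "obs_rank C A l = n"
    unfolding l_def obs_index_def using obs unfolding observable_def by (rule LeastI_ex)
  \<comment> \<open>\<open>Rx\<close> is applied twice below: to the recorded experiment with its
    given inputs, and to closed-loop solutions with input \<open>K chi\<close>.\<close>
  from observable_state_from_window[OF A B C rk] obtain R where R: "R \<in> carrier_mat n N" and
    Rx: "\<And>x u k. x k \<in> carrier_vec n \<Longrightarrow>
      (\<forall>j<l. u (k + j) \<in> carrier_vec m \<and> x (Suc (k + j)) = A *\<^sub>v x (k + j) + B *\<^sub>v u (k + j)) \<Longrightarrow>
      x (k + l) = R *\<^sub>v (stackv p (\<lambda>j. C *\<^sub>v x j) k l @\<^sub>v stackv m u k l)"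
    unfolding N_def by blast
  define Z where "Z = C * R"
  have Z: "Z \<in> carrier_mat p N" using C R by (simp add: Z_def)
  obtain S where S: "mat_inverse P = Some S" "S \<in> carrier_mat N N" "P * S = 1\<^sub>m N" "S * P = 1\<^sub>m N"
    using pd_mat_inverse[OF P] by blast
  have KS: "K = Y * S" using K S(1) by simp
  have Kc: "K \<in> carrier_mat m N" using KS Y S by simp
  have Pc: "P \<in> carrier_mat N N" "transpose_mat P = P" using P by (auto simp: pd_mat_def)
  have St: "transpose_mat S = S" by (rule right_inverse_of_symmetric_is_symmetric[OF Pc S(2,3)])
  \<comment> \<open>Positivity passes to the inverse: the form of \<open>S\<close> at
    \<open>v\<close> is the form of \<open>P\<close> at \<open>S v\<close>.\<close>
  have Snn: "0 \<le> v \<bullet> (S *\<^sub>v v)" if v: "v \<in> carrier_vec N" for v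
  proof -
    have "P *\<^sub>v (S *\<^sub>v v) = v" using assoc_mult_mat_vec[OF Pc(1) S(2) v] S(3) v by simp
    moreover have "0 \<le> (S *\<^sub>v v) \<bullet> (P *\<^sub>v (S *\<^sub>v v))"
      using pd_mat_imp_psd_mat[OF P] S(2) v by (auto simp: psd_mat_def)
    ultimately show ?thesis using comm_scalar_prod[of v N "S *\<^sub>v v"] S(2) v by simp
  qed
  have F: "F \<in> carrier_mat N N" and L: "L \<in> carrier_mat N p" and Bl: "Bl \<in> carrier_mat N m"
    by (simp_all add: F_def L_def Bl_def N_def)
  have Psi: "Psi0 \<in> carrier_mat N (T - l + 1)" "Psi1 \<in> carrier_mat N (T - l + 1)"
    by (simp_all add: Psi0_def Psi1_def Psi_mat_def cols_mat_def N_def)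
  have D: "Delta10 \<in> carrier_mat (p + N) (T - l + 1)"
    by (simp add: Delta10_def Delta10_mat_def cols_mat_def N_def add.assoc)
  have Thc: "Th \<in> carrier_mat (p + N) (p + N)" "transpose_mat Th = Th" using Th by (auto simp: psd_mat_def)
  have AAc: "AA \<in> carrier_mat N N" and BBc: "BB \<in> carrier_mat p N" and CCc: "CC \<in> carrier_mat p p"
    using Psi L unfolding AA_def BB_def CC_def Th11_def Th12_def Th22_def
    by (auto intro!: minus_carrier_mat)
  have xc: "x k \<in> carrier_vec n" if "k \<le> T" for k
    using that by (induction k) (use x0 dyn A B sig in auto)
  \<comment> \<open>Once \<open>chi\<close> is a true window, \<open>C x = Z chi\<close>, so the
    injected measurement \<open>L y\<close> becomes the feedback term
    \<open>L Z chi\<close>.\<close>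
  define M where "M = F + Bl * K + L * Z"
  have M: "M \<in> carrier_mat N N" using F Bl Kc L Z by (simp add: M_def)
  have dec: "(M *\<^sub>v v) \<bullet> (S *\<^sub>v (M *\<^sub>v v)) < v \<bullet> (S *\<^sub>v v)" if v: "v \<in> carrier_vec N" "v \<noteq> 0\<^sub>v N" for v
  proof -
    \<comment> \<open>For \<open>l = 0\<close> the matrices \<open>Psi0\<close>, \<open>Psi1\<close> and \<open>L\<close> have no rows and \<open>data_residual\<close> fails,
      but then \<open>v\<close> has dimension 0.\<close>
    have "l > 0"
    proof (rule ccontr)
      assume "\<not> l > 0"
      then have "N = 0" by (simp add: N_def)
      then show False using v by auto
    qed
    have "C *\<^sub>v x (j + l) = Z *\<^sub>v (stackv p (\<lambda>k. C *\<^sub>v x k) j l @\<^sub>v stackv m u j l)" if j: "j + l \<le> T" for j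
    proof -
      have "x (j + l) = R *\<^sub>v (stackv p (\<lambda>k. C *\<^sub>v x k) j l @\<^sub>v stackv m u j l)"
        using j xc sig dyn by (intro Rx) auto
      then show ?thesis
        unfolding Z_def by (subst assoc_mult_mat_vec[OF C R]) (auto simp: N_def)
    qed
    then have res: "transpose_mat Psi1 *\<^sub>v (L *\<^sub>v w) + transpose_mat Psi0 *\<^sub>v z = transpose_mat Delta10 *\<^sub>v (w @\<^sub>v z)"
      if "w \<in> carrier_vec p" "z = - (transpose_mat Z *\<^sub>v w)" for w z
      unfolding Psi1_def Psi0_def L_def Delta10_def ym_def um_def
      using \<open>l > 0\<close> T C Z xc sig that by (intro data_residual) (auto simp: N_def)
    have data: "w \<bullet> (CC *\<^sub>v w) - 2 * (w \<bullet> (BB *\<^sub>v z)) + z \<bullet> (AA *\<^sub>v z) \<le> 0"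
      if "w \<in> carrier_vec p" "z = - (transpose_mat Z *\<^sub>v w)" for w z
      unfolding CC_def BB_def AA_def
      using that Z by (intro data_consistency_inequality[OF L Psi Z Thc D noise _ _ res]) auto
    have "M *\<^sub>v v = F *\<^sub>v v + (Bl * (Y * S)) *\<^sub>v v + L *\<^sub>v (Z *\<^sub>v v)"
      unfolding M_def KS[symmetric] using F Bl Kc L Z v
      by (simp add: add_mult_distrib_mat_vec[of _ N N] assoc_mult_mat_vec[of L N p]
          assoc_add_vec[of _ N])
    from lyapunov_decrease_from_lmi[OF Pc L CCc BBc AAc F Bl Y LMI Z S(2,3) data v this]
    show ?thesis
      using M S(2) v comm_scalar_prod[of "M *\<^sub>v v" N "S *\<^sub>v (M *\<^sub>v v)"] comm_scalar_prod[of v N "S *\<^sub>v v"]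
      by simp
  qed
  have window: "chi k = stackv p (\<lambda>i. C *\<^sub>v xs i) (k - l) l @\<^sub>v stackv m (\<lambda>i. K *\<^sub>v chi i) (k - l) l"
    and xs_R: "xs k = R *\<^sub>v chi k" and chi_M: "chi (Suc k) = M *\<^sub>v chi k"
    if sol: "cl_solution n N A B C F L Bl K xs chi" and k: "k \<ge> l" for xs chi k
  proof -
    note s = sol[unfolded cl_solution_def]
    note c = cl_solution_carrier[OF A B C F L Bl Kc sol]
    have "chi (Suc k) = F *\<^sub>v chi k + Bl *\<^sub>v (K *\<^sub>v chi k) + L *\<^sub>v (C *\<^sub>v xs k)" for k
      using s c[of k] F Bl Kc
      by (simp add: add_mult_distrib_mat_vec[of _ N N] assoc_mult_mat_vec[of Bl N m])
    then show win: "chi k = stackv p (\<lambda>i. C *\<^sub>v xs i) (k - l) l @\<^sub>v stackv m (\<lambda>i. K *\<^sub>v chi i) (k - l) l"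
      using c C Kc k unfolding F_def Bl_def L_def N_def
      by (intro shift_register_window) (auto intro: mult_mat_vec_carrier)
    \<comment> \<open>The samples in \<open>chi k\<close> end at time \<open>k - 1\<close>, yet they
      determine the state at time \<open>k\<close>, since the input at \<open>k - 1\<close> is among
      them.\<close>
    have "xs (k - l + l) = R *\<^sub>v (stackv p (\<lambda>i. C *\<^sub>v xs i) (k - l) l @\<^sub>v stackv m (\<lambda>i. K *\<^sub>v chi i) (k - l) l)"
      using s c Kc by (intro Rx) (auto intro: mult_mat_vec_carrier)
    then show xR: "xs k = R *\<^sub>v chi k" using win k by simp
    have "L *\<^sub>v (C *\<^sub>v xs k) = (L * Z) *\<^sub>v chi k"
      unfolding xR Z_def using c[of k] L C R
      by (simp add: assoc_mult_mat_vec[of C p n R N] assoc_mult_mat_vec[of L N p "C * R" N])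
    moreover have "M *\<^sub>v chi k = (F + Bl * K) *\<^sub>v chi k + (L * Z) *\<^sub>v chi k"
      unfolding M_def using c[of k] F Bl Kc L Z by (intro add_mult_distrib_mat_vec[of _ N N]) auto
    ultimately show "chi (Suc k) = M *\<^sub>v chi k" using s by simp
  qed
  have "cl_GAS n N A B C F L Bl K"
    using cl_GAS_of_tail_reduction[OF A B C F L Bl Kc S(2) St Snn M R dec] xs_R chi_M by blast
  then show ?thesis using window by blast
qed

end
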